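(* Let $m\le 1$ and $\mathcal{S}=\{m,\ldots,-1\}\cup\{1\}$. Let $\mathbf{c}_0=(0,\ldots,0,c_0^1)\in\mathbb{N}^{2-m}$. Let $n(i,s,\mathbf{c})$ be non-negative integers, for $i\in\mathbb{Z}$, $s\in\mathcal{S}$ and $\mathbf{c}=(c^m,\ldots,c^1)\in\mathbb{N}^{2-m}$, such that $n(i,s,\mathbf{c})=0$ if $i<0$ or $c^0>0$, and satisfying the compatibility condition $\chi_{i=s}c_0^s+\sum_{t\in\mathcal{S},\mathbf{c}}c^s\,n(i-s,t,\mathbf{c})=\sum_{\mathbf{c}}n(i,s,\mathbf{c})$ for all $i,s$ (where $c_0^s$ is the $s$-component of $\mathbf{c}_0$). Let $n_i=\chi_{i=0}+\sum_{s,\mathbf{c}}n(i,s,\mathbf{c})$, let $r$ be the largest $i$ with $n_i>0$, assume $n_i>0$ for $0\le i\le r$, and let $n=\sum_i n_i$, $n(i,s)=\sum_{\mathbf{c}}n(i,s,\mathbf{c})$, $n_s(b)=\sum_{i,t}\sum_{\mathbf{c}:c^s=b}n(i,t,\mathbf{c})+\chi_{s=1,\,b=c_0^1}$, and $n_1(i,1,b)=\sum_{\mathbf{c}:c^1=b}n(i,1,\mathbf{c})$. Then the number of $\mathcal{S}$-embedded Cayley trees in which the root has in-type $(0;\mathbf{c}_0)$ and, for all $i,s,\mathbf{c}$, exactly $n(i,s,\mathbf{c})$ non-root vertices have type $(i;s;\mathbf{c})$ is $$\frac{c_0^1\, n!\prod_{i,s}n(i,s)!}{\prod_{i,s,\mathbf{c}}n(i,s,\mathbf{c})!\prod_{i=1}^r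 n(i,1)\prod_{b\ge0,\,s}b!^{\,n_s(b)}}\prod_{i=1}^{r-1}\Big(\sum_{b>0}b\,n_1(i,1,b)\Big).$$
   Context: An $\mathcal{S}$-embedded Cayley tree is a tree on vertex set $\{1,\ldots,n\}$ with a distinguished root, together with abscissas $a(v)\in\mathbb{Z}$ such that the root has abscissa $0$ and $a(v')-a(v)\in\mathcal{S}$ whenever $v'$ is a child of $v$. A vertex $v$ has in-type $(i;\mathbf{c})$, $\mathbf{c}=(c^m,\ldots,c^1)$, if $a(v)=i$ and for each $m\le k\le 1$ it has exactly $c^k$ children at abscissa $i+k$. A non-root vertex has type $(i;s;\mathbf{c})$ if it has in-type $(i;\mathbf{c})$ and its parent lies at abscissa $i-s$. Thus $n(i,s)$ counts non-root vertices at abscissa $i$ with parent at abscissa $i-s$, $n_s(b)$ counts vertices $v$ with exactly $b$ children at abscissa $a(v)+s$, and $n_1(i,1,b)$ counts vertices at abscissa $i$ with parent at abscissa $i-1$ and exactly $b$ children at abscissa $i+1$. $\chi_P$ is $1$ if $P$ holds and $0$ otherwise.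
   Formalization: The case r = 0 is excluded: there the only tree is a single vertex (count 1) while the formula gives 0 because c_0^1 = 0; where some n(i,1) = 0 with 1 ≤ i ≤ r the displayed 0/0 is read as 0; the family n(i,s,c) is taken to have finite support. *)

theory Defs
  imports Complex_Main "HOL-Library.FuncSet" "HOL-Library.Groups_Big_Fun"
begin

text \<open>Simple undirected graphs are given by a vertex set and a set of two-element edges.\<close>

definition upath :: "'a set set \<Rightarrow> 'a list \<Rightarrow> bool" where
  "upath E xs \<longleftrightarrow> xs \<noteq> [] \<and> distinct xs \<and> successively (\<lambda>u v. {u, v} \<in> E) xs"

definition ucycle :: "'a set set \<Rightarrow> 'a list \<Rightarrow> bool" where
  "ucycle E xs \<longleftrightarrow> upath E xs \<and> length xs \<ge> 3 \<and> {last xs, hd xs} \<in> E"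

definition utree :: "'a set \<Rightarrow> 'a set set \<Rightarrow> bool" where
  "utree V E \<longleftrightarrow>
     V \<noteq> {} \<and>
     (\<forall>e\<in>E. e \<subseteq> V \<and> card e = 2) \<and>
     (\<forall>u\<in>V. \<forall>v\<in>V. \<exists>xs. upath E xs \<and> hd xs = u \<and> last xs = v) \<and>
     (\<nexists>xs. ucycle E xs)"

text \<open>\<open>w\<close> is a child of \<open>v\<close> if \<open>v\<close> is the last vertex before \<open>w\<close> on the path from the root
  \<open>\<rho>\<close> to \<open>w\<close>.\<close>

definition is_child :: "'a set set \<Rightarrow> 'a \<Rightarrow> 'a \<Rightarrow> 'a \<Rightarrow> bool" where
  "is_child E \<rho> v w \<longleftrightarrow> (\<exists>xs. upath E (xs @ [v, w]) \<and> hd (xs @ [v, w]) = \<rho>)"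

text \<open>The abscissa function is required to be extensional, so that it is determined by its
  values on the vertices and distinct triples are distinct embedded trees.\<close>

definition embedded_cayley_trees ::
  "int set \<Rightarrow> nat \<Rightarrow> (nat set set \<times> nat \<times> (nat \<Rightarrow> int)) set" where
  "embedded_cayley_trees S n =
     {(E, \<rho>, a). utree {1..n} E \<and> \<rho> \<in> {1..n} \<and> a \<in> extensional {1..n} \<and> a \<rho> = 0 \<and>
        (\<forall>v\<in>{1..n}. \<forall>w\<in>{1..n}. is_child E \<rho> v w \<longrightarrow> a w - a v \<in> S)}"

definition has_in_type ::
  "int \<Rightarrow> 'a set set \<Rightarrow> 'a \<Rightarrow> ('a \<Rightarrow> int) \<Rightarrow> 'a \<Rightarrow> int \<Rightarrow> (int \<Rightarrow> nat) \<Rightarrow> bool" where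
  "has_in_type m E \<rho> a v i c \<longleftrightarrow>
     a v = i \<and> (\<forall>k\<in>{m..1}. card {w. is_child E \<rho> v w \<and> a w = i + k} = c k)"

definition has_type ::
  "int \<Rightarrow> 'a set set \<Rightarrow> 'a \<Rightarrow> ('a \<Rightarrow> int) \<Rightarrow> 'a \<Rightarrow> int \<Rightarrow> int \<Rightarrow> (int \<Rightarrow> nat) \<Rightarrow> bool" where
  "has_type m E \<rho> a v i s c \<longleftrightarrow>
     has_in_type m E \<rho> a v i c \<and> (\<exists>u. is_child E \<rho> u v \<and> a u = i - s)"

definition steps :: "int \<Rightarrow> int set" where
  "steps m = {m..-1} \<union> {1}"

text \<open>A vector \<open>(c\<^sup>m, \<dots>, c\<^sup>1)\<close> is a function on the integers that vanishes off \<open>{m..1}\<close>.\<close>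

definition child_vectors :: "int \<Rightarrow> (int \<Rightarrow> nat) set" where
  "child_vectors m = {c. \<forall>k. k \<notin> {m..1} \<longrightarrow> c k = 0}"

definition trees_of_type ::
  "int \<Rightarrow> (int \<Rightarrow> nat) \<Rightarrow> (int \<Rightarrow> int \<Rightarrow> (int \<Rightarrow> nat) \<Rightarrow> nat) \<Rightarrow> nat \<Rightarrow>
     (nat set set \<times> nat \<times> (nat \<Rightarrow> int)) set" where
  "trees_of_type m c0 f n =
     {(E, \<rho>, a). (E, \<rho>, a) \<in> embedded_cayley_trees (steps m) n \<and>
        has_in_type m E \<rho> a \<rho> 0 c0 \<and>
        (\<forall>i. \<forall>s\<in>steps m. \<forall>c\<in>child_vectors m.
           card {v \<in> {1..n} - {\<rho>}. has_type m E \<rho> a v i s c} = f i s c)}"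

text \<open>In the following, \<open>f i s c\<close> is \<open>n(i,s,\<^bold>c)\<close>, extended by \<open>0\<close> to all arguments and of
  finite support. \<open>Sum_any\<close> and \<open>Prod_any\<close> are the sum and product over a whole type of a
  function with finitely many non-neutral values. The five definitions are
  \<open>n(i,s)\<close>, \<open>n\<^sub>i\<close>, \<open>n\<close>, \<open>n\<^sub>s(b)\<close> and \<open>n\<^sub>1(i,1,b)\<close>.\<close>

definition n_step :: "(int \<Rightarrow> int \<Rightarrow> (int \<Rightarrow> nat) \<Rightarrow> nat) \<Rightarrow> int \<Rightarrow> int \<Rightarrow> nat" where
  "n_step f i s = Sum_any (\<lambda>c. f i s c)"

definition n_level :: "int \<Rightarrow> (int \<Rightarrow> int \<Rightarrow> (int \<Rightarrow> nat) \<Rightarrow> nat) \<Rightarrow> int \<Rightarrow> nat" where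
  "n_level m f i = of_bool (i = 0) + (\<Sum>s\<in>steps m. Sum_any (\<lambda>c. f i s c))"

definition n_total :: "int \<Rightarrow> (int \<Rightarrow> int \<Rightarrow> (int \<Rightarrow> nat) \<Rightarrow> nat) \<Rightarrow> nat" where
  "n_total m f = Sum_any (\<lambda>i. n_level m f i)"

definition n_children ::
  "int \<Rightarrow> (int \<Rightarrow> nat) \<Rightarrow> (int \<Rightarrow> int \<Rightarrow> (int \<Rightarrow> nat) \<Rightarrow> nat) \<Rightarrow> int \<Rightarrow> nat \<Rightarrow> nat" where
  "n_children m c0 f s b =
     Sum_any (\<lambda>i. \<Sum>t\<in>steps m. Sum_any (\<lambda>c. if c s = b then f i t c else 0)) +
     of_bool (s = 1 \<and> b = c0 1)"

definition n_up :: "(int \<Rightarrow> int \<Rightarrow> (int \<Rightarrow> nat) \<Rightarrow> nat) \<Rightarrow> int \<Rightarrow> nat \<Rightarrow> nat" where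
  "n_up f i b = Sum_any (\<lambda>c. if c 1 = b then f i 1 c else 0)"

end

theory Submission
  imports Defs
begin

text \<open>
  Fix the root and the type of every other vertex. Give every vertex \<open>c\<^sup>s\<close> slots for its children at
  relative abscissa \<open>s\<close>; the slots offered to the class \<open>(i, s)\<close> of vertices at abscissa \<open>i\<close> with
  parent at \<open>i - s\<close> are as many as the vertices of that class, so the candidate parent maps are the
  class preserving bijections from vertices to slots, and the trees are the acyclic ones.

  The number of acyclic bijections is \<open>\<Prod> (n\<^sub>k - 1)!\<close>, over all classes \<open>k\<close>, times the number of
  ways to pick one slot for every class so that the induced map from classes to classes (class of
  the owner of the slot) is acyclic. This is proved by induction: if a class has at least two
  vertices, reveal the slot of one of them and merge this vertex into its parent; exchanging the
  revealed slot with the slot picked for the class shows that the merging does not change the count.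

  Since abscissas decrease by at most one from child to parent, the map on classes is acyclic iff it
  sends \<open>(i, 1)\<close> to \<open>(i - 1, 1)\<close> for \<open>1 \<le> i \<le> r\<close>, the root counting as \<open>(0, 1)\<close>. This gives the
  factors \<open>c\<^sub>0\<^sup>1\<close> and \<open>\<Sum> b n\<^sub>1(i, 1, b)\<close>.
\<close>

subsection \<open>Acyclic maps\<close>

text \<open>Slots make it possible to reveal a map one vertex at a time, whereas the fibre sizes of
  a parent map constrain all vertices together. Permuting the slots of one owner within one class
  leaves the parent map unchanged, which is the source of the factors b!. Distributing the types
  over the non-root vertices gives (n-1)! divided by all n(i,s,c)!, and the choice of the root turns
  (n-1)! into n!.

  The obstacle is that the acyclicity condition obtained after a merge differs from the original
  one: the two conditions do not agree choice by choice, only after summing over the two states of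
  an exchange of slots.

  In the final product a class with step other than 1 picks its slot freely, which completes (n_k -
  1)! to n_k!. A class (i, 1) with 1 <= i <= r may not, which leaves n(i,1)! / n(i,1). If one of
  these n(i,1) vanishes there is no tree, and the formula yields 0 because division by zero is
  0.\<close>

definition arcs :: "'a set \<Rightarrow> ('a \<Rightarrow> 'a) \<Rightarrow> ('a \<times> 'a) set" where
  "arcs A q = (\<lambda>x. (x, q x)) ` A"

text \<open>Points outside \<open>A\<close> emit no arc. On a finite \<open>A\<close> the condition
  therefore says that iterating \<open>q\<close> from any point of \<open>A\<close> eventually
  leaves \<open>A\<close>; for a parent map the only exit is the root.\<close>

definition acyclic_map :: "'a set \<Rightarrow> ('a \<Rightarrow> 'a) \<Rightarrow> bool" where
  "acyclic_map A q \<longleftrightarrow> acyclic (arcs A q)"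

lemma in_arcs_iff: "(x, y) \<in> arcs A q \<longleftrightarrow> x \<in> A \<and> y = q x"
  by (auto simp: arcs_def)

lemma arcs_cong: "(\<And>x. x \<in> A \<Longrightarrow> q x = q' x) \<Longrightarrow> arcs A q = arcs A q'"
  by (auto simp: arcs_def)

lemma acyclic_map_cong:
  "(\<And>x. x \<in> A \<Longrightarrow> q x = q' x) \<Longrightarrow> acyclic_map A q \<longleftrightarrow> acyclic_map A q'"
  unfolding acyclic_map_def using arcs_cong[of A q q'] by simp

lemma acyclic_map_by_rank:
  fixes d :: "'a \<Rightarrow> nat"
  assumes "\<And>x. x \<in> A \<Longrightarrow> d (q x) < d x"
  shows "acyclic_map A q"
proof -
  have "acyclic ((arcs A q)\<inverse>)"
    by (rule wf_acyclic, rule wf_subset[OF wf_measure[of d]]) (auto simp: in_arcs_iff assms)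
  then show ?thesis by (simp add: acyclic_map_def)
qed

text \<open>The working criterion: arguments about cycles become choices of a closed set. A closed
  set has no minimal element for the converse arcs, and a cycle yields a closed set.\<close>

lemma acyclic_map_iff_no_closed_subset:
  assumes "finite A"
  shows "acyclic_map A q \<longleftrightarrow> (\<forall>B\<subseteq>A. B \<noteq> {} \<longrightarrow> (\<exists>x\<in>B. q x \<notin> B))"
proof
  assume ac: "acyclic_map A q"
  have "wf ((arcs A q)\<inverse>)"
    using ac assms by (intro finite_acyclic_wf_converse) (auto simp: acyclic_map_def arcs_def)
  then have min: "\<exists>z\<in>B. \<forall>y. (y, z) \<in> (arcs A q)\<inverse> \<longrightarrow> y \<notin> B" if "B \<noteq> {}" for B
    using that unfolding wf_eq_minimal by (metis ex_in_conv)
  show "\<forall>B\<subseteq>A. B \<noteq> {} \<longrightarrow> (\<exists>x\<in>B. q x \<notin> B)"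
  proof (intro allI impI)
    fix B assume "B \<subseteq> A" "B \<noteq> {}"
    with min[of B] show "\<exists>x\<in>B. q x \<notin> B" by (auto simp: in_arcs_iff)
  qed
next
  assume cl: "\<forall>B\<subseteq>A. B \<noteq> {} \<longrightarrow> (\<exists>x\<in>B. q x \<notin> B)"
  show "acyclic_map A q"
    unfolding acyclic_map_def acyclic_def
  proof (intro allI notI)
    fix x assume x: "(x, x) \<in> (arcs A q)\<^sup>+"
    \<comment> \<open>These are the points on closed walks through \<open>x\<close>. The only arc
      out of such a \<open>y\<close> goes to \<open>q y\<close>, so the walk passes through
      \<open>q y\<close> and \<open>B\<close> is closed.\<close>
    define B where "B = {y. (y, x) \<in> (arcs A q)\<^sup>+ \<and> (x, y) \<in> (arcs A q)\<^sup>*}"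
    have "B \<subseteq> A" unfolding B_def by (auto simp: in_arcs_iff dest!: tranclD)
    moreover have "x \<in> B" using x by (simp add: B_def)
    moreover have "q y \<in> B" if "y \<in> B" for y
    proof -
      have y: "(y, x) \<in> (arcs A q)\<^sup>+" "(x, y) \<in> (arcs A q)\<^sup>*" using that by (auto simp: B_def)
      obtain z where z: "(y, z) \<in> arcs A q" "(z, x) \<in> (arcs A q)\<^sup>*" using tranclD[OF y(1)] by blast
      then have "z = q y" by (simp add: in_arcs_iff)
      moreover have "(z, x) \<in> (arcs A q)\<^sup>+" using z(2) x by (rule rtrancl_trancl_trancl)
      moreover have "(x, z) \<in> (arcs A q)\<^sup>*" using y(2) z(1) by simp
      ultimately show ?thesis by (simp add: B_def)
    qed
    ultimately show False using cl by blast
  qed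
qed

text \<open>Deleting \<open>v\<close> and redirecting its preimages to \<open>q v\<close> shortens
  each cycle through \<open>v\<close> by one arc. Only a loop at \<open>v\<close> gets lost, hence
  the separate condition on \<open>q v\<close>.\<close>

lemma acyclic_map_bypass:
  assumes "finite A" "v \<notin> A"
  shows "acyclic_map (insert v A) q \<longleftrightarrow>
    q v \<noteq> v \<and> acyclic_map A (\<lambda>x. if q x = v then q v else q x)"
    (is "_ \<longleftrightarrow> _ \<and> acyclic_map A ?q")
proof (intro iffI conjI)
  assume "acyclic_map (insert v A) q"
  then have ac: "\<exists>x\<in>B. q x \<notin> B" if "B \<subseteq> insert v A" "B \<noteq> {}" for B
    using that acyclic_map_iff_no_closed_subset[of "insert v A" q] assms by blast
  show loop: "q v \<noteq> v" using ac[of "{v}"] by auto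
  show "acyclic_map A ?q"
    unfolding acyclic_map_iff_no_closed_subset[OF assms(1)]
  proof (intro allI impI, rule ccontr)
    fix B assume B: "B \<subseteq> A" "B \<noteq> {}" "\<not> (\<exists>x\<in>B. ?q x \<notin> B)"
    show False
    proof (cases "\<exists>x\<in>B. q x = v")
      case True
      then have "q v \<in> B" using B(3) by force
      then have "q x \<in> insert v B" if "x \<in> insert v B" for x
        using that B(3) by (cases "q x = v") auto
      then show False using ac[of "insert v B"] B(1) by auto
    next
      case False
      then show False using ac[of B] B by fastforce
    qed
  qed
next
  assume asm: "q v \<noteq> v \<and> acyclic_map A ?q"
  then have ac: "\<exists>x\<in>B. ?q x \<notin> B" if "B \<subseteq> A" "B \<noteq> {}" for B
    using that acyclic_map_iff_no_closed_subset[of A ?q] assms by blast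
  have fin: "finite (insert v A)" using assms by simp
  show "acyclic_map (insert v A) q"
    unfolding acyclic_map_iff_no_closed_subset[OF fin]
  proof (intro allI impI, rule ccontr)
    fix B assume B: "B \<subseteq> insert v A" "B \<noteq> {}" "\<not> (\<exists>x\<in>B. q x \<notin> B)"
    have "B \<noteq> {v}" using B(3) asm by auto
    then have "B - {v} \<noteq> {}" using B(2) by auto
    then obtain x where x: "x \<in> B - {v}" "?q x \<notin> B - {v}" using ac[of "B - {v}"] B(1) by auto
    then show False using B(3) asm by (auto split: if_splits)
  qed
qed

lemma acyclic_map_contract:
  assumes "finite A" "v \<notin> A" "\<And>x. x \<in> A \<Longrightarrow> q' x = (if q x = v then q v else q x)"
  shows "acyclic_map (insert v A) q \<longleftrightarrow> q v \<noteq> v \<and> acyclic_map A q'"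
  using acyclic_map_bypass[OF assms(1,2), of q] acyclic_map_cong[OF assms(3)] by simp

text \<open>Injectivity has to cover the values of \<open>q\<close> as well: otherwise an exit from
  \<open>A\<close> could be identified with a point of \<open>A\<close> and close a cycle.\<close>

lemma acyclic_map_image:
  assumes "finite A" "inj_on \<iota> (A \<union> q ` A)" "\<And>x. x \<in> A \<Longrightarrow> q' (\<iota> x) = \<iota> (q x)"
  shows "acyclic_map (\<iota> ` A) q' \<longleftrightarrow> acyclic_map A q"
proof -
  have fin: "finite (\<iota> ` A)" using assms by simp
  have "(\<exists>y\<in>\<iota> ` B. q' y \<notin> \<iota> ` B) \<longleftrightarrow> (\<exists>x\<in>B. q x \<notin> B)" if B: "B \<subseteq> A" for B
  proof -
    have "q' (\<iota> x) \<in> \<iota> ` B \<longleftrightarrow> q x \<in> B" if "x \<in> B" for x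
    proof -
      have "q' (\<iota> x) = \<iota> (q x)" "q x \<in> A \<union> q ` A" using assms(3) that B by auto
      then show ?thesis using inj_on_image_mem_iff[OF assms(2), of "q x" B] B by auto
    qed
    then show ?thesis by auto
  qed
  then show ?thesis
    unfolding acyclic_map_iff_no_closed_subset[OF fin] acyclic_map_iff_no_closed_subset[OF assms(1)]
    by (auto simp: all_subset_image)
qed

lemma rtrancl_arcs_exit_unique:
  assumes "(x, u) \<in> (arcs A q)\<^sup>*" "(x, v) \<in> (arcs A q)\<^sup>*" "u \<notin> A" "v \<notin> A"
  shows "u = v"
  using assms(1,2)
proof (induction rule: converse_rtrancl_induct)
  case base
  then show ?case using assms(3) by (auto elim: converse_rtranclE simp: in_arcs_iff)
next
  case (step x y)
  from step.prems have "x = v \<or> (y, v) \<in> (arcs A q)\<^sup>*"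
    using step.hyps(1) by (auto elim: converse_rtranclE simp: in_arcs_iff)
  then show ?case using step assms(4) by (auto simp: in_arcs_iff)
qed

text \<open>Following the pointers of \<open>R\<close> from \<open>x\<close> and from \<open>y\<close>, one leaves \<open>R\<close> at \<open>v\<close>, at \<open>k\<close> or
  elsewhere; both sides depend only on these two exits.\<close>

lemma acyclic_map_swap:
  fixes q :: "'a \<Rightarrow> 'a"
  assumes "v \<notin> R" "k \<notin> R" "v \<noteq> k"
  defines "G \<equiv> \<lambda>x y. acyclic_map (insert v (insert k R)) (q(v := x, k := y))"
  shows "of_bool (G x y) + of_bool (G y x) = of_bool (G k y) + (of_bool (G k x) :: nat)"
proof -
  let ?r = "arcs R q"
  have G: "G x y \<longleftrightarrow> acyclic ?r \<and> (y, k) \<notin> ?r\<^sup>* \<and> (x, v) \<notin> ?r\<^sup>* \<and>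
      \<not> ((x, k) \<in> ?r\<^sup>* \<and> (y, v) \<in> ?r\<^sup>*)" for x y
  proof -
    have "arcs (insert v (insert k R)) (q(v := x, k := y)) = insert (v, x) (insert (k, y) ?r)"
      using assms(1-3) by (auto simp: arcs_def image_iff)
    then show ?thesis unfolding G_def acyclic_map_def
      by (auto simp: acyclic_insert rtrancl_insert)
  qed
  have kk: "(k, v) \<notin> ?r\<^sup>*"
    using assms(2,3) by (auto elim: converse_rtranclE simp: in_arcs_iff)
  have ex: "\<not> ((z, k) \<in> ?r\<^sup>* \<and> (z, v) \<in> ?r\<^sup>*)" for z
    using rtrancl_arcs_exit_unique[of z k R q v] assms by blast
  \<comment> \<open>Let the exits of \<open>x\<close> and \<open>y\<close> from \<open>R\<close> be
    \<open>v\<close>, \<open>k\<close> or other. \<open>G x y\<close> holds exactly for the pairs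
    (k, other), (other, v) and (other, other), while \<open>G k y\<close> says that \<open>y\<close>
    has exit other. Both sides thus count how many of \<open>x\<close> and \<open>y\<close> have
    exit other, provided \<open>R\<close> itself carries no cycle.\<close>
  show ?thesis unfolding G using kk ex[of x] ex[of y] by auto
qed

subsection \<open>Class preserving bijections\<close>

definition matchings :: "'a set \<Rightarrow> ('a \<Rightarrow> 'k) \<Rightarrow> 'b set \<Rightarrow> ('b \<Rightarrow> 'k) \<Rightarrow> ('a \<Rightarrow> 'b) set" where
  "matchings V h S hs = {g \<in> extensional V. bij_betw g V S \<and> (\<forall>v\<in>V. hs (g v) = h v)}"

lemma finite_matchings:
  assumes "finite V" "finite S"
  shows "finite (matchings V h S hs)"
proof (rule finite_subset)
  show "matchings V h S hs \<subseteq> PiE V (\<lambda>_. S)"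
    by (auto simp: matchings_def bij_betw_def PiE_def)
  show "finite (PiE V (\<lambda>_. S))" using assms by (intro finite_PiE) auto
qed

lemma matchings_insert:
  assumes "v \<notin> V"
  shows "bij_betw (\<lambda>(s, g). g(v := s))
     (SIGMA s:{s \<in> S. hs s = h v}. matchings V h (S - {s}) hs) (matchings (insert v V) h S hs)"
proof (rule bij_betw_byWitness[where f' = "\<lambda>g. (g v, restrict g V)"], goal_cases)
  case 1
  then show ?case using assms
    by (auto simp: matchings_def restrict_def extensional_def fun_eq_iff)
next
  case 2
  then show ?case using assms
    by (auto simp: matchings_def restrict_def extensional_def fun_eq_iff)
next
  case 3
  show ?case
  proof clarsimp
    fix s g assume s: "s \<in> S" "hs s = h v" and g: "g \<in> matchings V h (S - {s}) hs"
    have "bij_betw (g(v := s)) V (S - {s})"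
      using g assms by (subst bij_betw_cong[where g = g]) (auto simp: matchings_def)
    then have "bij_betw (g(v := s)) (insert v V) (insert s (S - {s}))"
      using assms notIn_Un_bij_betw[of v V "g(v := s)" "S - {s}"] by simp
    then show "g(v := s) \<in> matchings (insert v V) h S hs"
      using g s assms by (auto simp: matchings_def insert_absorb extensional_def)
  qed
next
  case 4
  show ?case
  proof clarsimp
    fix g assume g: "g \<in> matchings (insert v V) h S hs"
    then have b: "bij_betw g (insert v V) S" and *: "\<forall>w\<in>insert v V. hs (g w) = h w"
      by (auto simp: matchings_def)
    have "bij_betw g V (S - {g v})"
      using b assms by (auto simp: bij_betw_def image_iff)
    moreover have "g v \<in> S" using b by (auto simp: bij_betw_def)
    ultimately show "g v \<in> S \<and> hs (g v) = h v \<and> restrict g V \<in> matchings V h (S - {g v}) hs"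
      using * by (auto simp: matchings_def cong: bij_betw_cong)
  qed
qed

lemma card_fibre_remove:
  assumes "finite V" "finite S" "v \<in> V" "s \<in> S" "hs s = h v"
    and "card {w \<in> V. h w = k} = card {t \<in> S. hs t = k}"
  shows "card {w \<in> V - {v}. h w = k} = card {t \<in> S - {s}. hs t = k}"
proof -
  have "{w \<in> V - {v}. h w = k} = {w \<in> V. h w = k} - (if h v = k then {v} else {})"
    "{t \<in> S - {s}. hs t = k} = {t \<in> S. hs t = k} - (if h v = k then {s} else {})"
    using assms(5) by auto
  then show ?thesis using assms by (simp add: card_Diff_subset)
qed

lemma card_matchings:
  assumes "finite V" "finite S"
    and "\<And>k. card {v \<in> V. h v = k} = card {t \<in> S. hs t = k}"
  shows "card (matchings V h S hs) = (\<Prod>k\<in>h ` V. fact (card {v \<in> V. h v = k}))"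
  using assms
proof (induction V arbitrary: S rule: finite_induct)
  case empty
  have "card {t \<in> S. hs t = k} = 0" for k using empty.prems(2)[of k] by simp
  then have "S = {}" using empty.prems(1) by auto
  then show ?case by (simp add: matchings_def bij_betw_def Collect_conv_if)
next
  case (insert v V)
  define K where "K = {k \<in> h ` V. k \<noteq> h v}"
  define n where "n = card {w \<in> V. h w = h v}"
  have fibre_v: "{w \<in> insert v V. h w = h v} = insert v {w \<in> V. h w = h v}" by auto
  have n: "card {s \<in> S. hs s = h v} = Suc n"
    using insert.prems(2)[of "h v"] insert.hyps unfolding fibre_v by (simp add: n_def)
  have IH: "card (matchings V h (S - {s}) hs) = fact n * (\<Prod>k\<in>K. fact (card {w \<in> V. h w = k}))"
    if s: "s \<in> S" "hs s = h v" for s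
  proof -
    have eq: "card {w \<in> V. h w = k} = card {t \<in> S - {s}. hs t = k}" for k
      using card_fibre_remove[of "insert v V" S v s hs h k] insert s by simp
    have "card (matchings V h (S - {s}) hs) = (\<Prod>k\<in>h ` V. fact (card {v \<in> V. h v = k}))"
      using insert.IH[of "S - {s}"] insert.prems(1) eq by simp
    also have "\<dots> = (\<Prod>k\<in>insert (h v) K. fact (card {v \<in> V. h v = k}))"
    \<comment> \<open>If \<open>v\<close> is alone in its class, \<open>h v\<close> does not occur
      in the image of \<open>V\<close>; the factor inserted for it is then
      \<open>fact 0\<close>.\<close>
    proof (rule prod.mono_neutral_left)
      show "\<forall>i\<in>insert (h v) K - h ` V. fact (card {v \<in> V. h v = i}) = (1::nat)"
      proof
        fix i assume "i \<in> insert (h v) K - h ` V"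
        then have "{v \<in> V. h v = i} = {}" by auto
        then show "fact (card {v \<in> V. h v = i}) = (1::nat)" by (simp only: card.empty fact_0)
      qed
    qed (use insert.hyps in \<open>auto simp: K_def\<close>)
    also have "\<dots> = fact n * (\<Prod>k\<in>K. fact (card {w \<in> V. h w = k}))"
      using insert.hyps by (subst prod.insert) (auto simp: K_def n_def)
    finally show ?thesis .
  qed
  have "card (matchings (insert v V) h S hs) =
      card (SIGMA s:{s \<in> S. hs s = h v}. matchings V h (S - {s}) hs)"
    by (rule bij_betw_same_card[OF matchings_insert[OF insert.hyps(2)], symmetric])
  also have "\<dots> = (\<Sum>s\<in>{s \<in> S. hs s = h v}. card (matchings V h (S - {s}) hs))"
    using insert by (intro card_SigmaI) (auto intro: finite_matchings)
  also have "\<dots> = Suc n * (fact n * (\<Prod>k\<in>K. fact (card {w \<in> V. h w = k})))"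
    using IH n by simp
  also have "\<dots> = fact (Suc n) * (\<Prod>k\<in>K. fact (card {w \<in> insert v V. h w = k}))"
  proof -
    have "{w \<in> insert v V. h w = k} = {w \<in> V. h w = k}" if "k \<in> K" for k
      using that by (auto simp: K_def)
    then show ?thesis by (simp add: algebra_simps)
  qed
  also have "\<dots> = (\<Prod>k\<in>insert (h v) K. fact (card {w \<in> insert v V. h w = k}))"
  proof (subst prod.insert)
    show "fact (Suc n) * (\<Prod>k\<in>K. fact (card {w \<in> insert v V. h w = k})) =
        fact (card {w \<in> insert v V. h w = h v}) *
        (\<Prod>k\<in>K. fact (card {w \<in> insert v V. h w = k}))"
      unfolding fibre_v using insert.hyps by (simp add: n_def)
  qed (use insert.hyps in \<open>auto simp: K_def\<close>)
  also have "insert (h v) K = h ` insert v V" by (auto simp: K_def)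
  finally show ?case .
qed

text \<open>Bijections are grouped by the owner map they induce. Those that induce a given
  \<open>p\<close> are the matchings for the finer classes (class, owner), so every admissible
  \<open>p\<close> arises equally often. The lemma serves twice: to forget slot labels in favour of
  parent maps, and to derive the multinomial count of \<open>card_typings\<close>.\<close>

lemma card_matchings_by_owner:
  fixes own :: "'b \<Rightarrow> 'c"
  assumes V: "finite V" and S: "finite S"
  shows "card {g \<in> matchings V h S hs. P (restrict (own \<circ> g) V)} =
    card {p \<in> extensional V. P p \<and>
      (\<forall>k u. card {v \<in> V. h v = k \<and> p v = u} = card {t \<in> S. hs t = k \<and> own t = u})} *
    (\<Prod>y\<in>(\<lambda>t. (hs t, own t)) ` S. fact (card {t \<in> S. (hs t, own t) = y}))"
    (is "card ?G = card ?P * ?c")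
proof -
  let ?hs = "\<lambda>t. (hs t, own t)"
  define M where "M p = matchings V (\<lambda>v. (h v, p v)) S ?hs" for p
  have fibre: "card {v \<in> V. (h v, p v) = y} = card {t \<in> S. ?hs t = y}"
    if "p \<in> ?P" for p y
    using that by (cases y) simp
  have "bij_betw snd (SIGMA p:?P. M p) ?G"
  proof (rule bij_betw_byWitness[where f' = "\<lambda>g. (restrict (own \<circ> g) V, g)"], goal_cases)
    case 1
    show ?case by (auto simp: M_def matchings_def restrict_def extensional_def fun_eq_iff)
  next
    case 2
    show ?case by simp
  next
    case 3
    have "restrict (own \<circ> g) V = p" if "p \<in> ?P" "g \<in> M p" for p g
      using that by (auto simp: M_def matchings_def restrict_def extensional_def fun_eq_iff)
    then show ?case by (fastforce simp: M_def matchings_def)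
  next
    case 4
    show ?case
    proof (rule image_subsetI)
      fix g assume "g \<in> ?G"
      then have g: "g \<in> matchings V h S hs" "P (restrict (own \<circ> g) V)" by auto
      have "g \<in> M (restrict (own \<circ> g) V)" using g by (auto simp: M_def matchings_def)
      moreover have "card {v \<in> V. h v = k \<and> restrict (own \<circ> g) V v = u} =
          card {t \<in> S. hs t = k \<and> own t = u}" for k u
      proof -
      have "bij_betw g {v \<in> V. h v = k \<and> own (g v) = u} {t \<in> S. hs t = k \<and> own t = u}"
        using g(1) by (auto simp: matchings_def bij_betw_def inj_on_def)
      from bij_betw_same_card[OF this]
      show ?thesis by (simp cong: conj_cong)
      qed
      ultimately show "(restrict (own \<circ> g) V, g) \<in> (SIGMA p:?P. M p)" using g by auto
    qed
  qed
  from bij_betw_same_card[OF this, symmetric] have "card ?G = card (SIGMA p:?P. M p)" .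
  also have "\<dots> = (\<Sum>p\<in>?P. card (M p))"
  proof (rule card_SigmaI)
    have "p \<in> PiE V (\<lambda>_. own ` S)" if "p \<in> ?P" for p
    proof (rule PiE_I)
      fix v assume v: "v \<in> V"
      have "card {w \<in> V. h w = h v \<and> p w = p v} \<noteq> 0"
        using v V by auto
      then have "card {t \<in> S. hs t = h v \<and> own t = p v} \<noteq> 0" using that by simp
      then have "{t \<in> S. hs t = h v \<and> own t = p v} \<noteq> {}" by (metis card.empty)
      then show "p v \<in> own ` S" by force
    qed (use that in \<open>auto simp: extensional_def\<close>)
    then show "finite ?P" using V S
      by (intro finite_subset[of ?P "PiE V (\<lambda>_. own ` S)"] finite_PiE) auto
  qed (use V S in \<open>auto simp: M_def intro!: finite_matchings\<close>)
  also have "\<dots> = (\<Sum>p\<in>?P. ?c)"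
  proof (rule sum.cong[OF refl])
    fix p assume p: "p \<in> ?P"
    have "card (M p) = (\<Prod>y\<in>(\<lambda>v. (h v, p v)) ` V. fact (card {v \<in> V. (h v, p v) = y}))"
      unfolding M_def by (rule card_matchings[OF V S fibre[OF p]])
    also have "\<dots> = (\<Prod>y\<in>?hs ` S. fact (card {t \<in> S. ?hs t = y}))"
    proof (rule prod.cong)
      have "y \<in> (\<lambda>v. (h v, p v)) ` V \<longleftrightarrow> y \<in> ?hs ` S" for y
      proof -
        have "y \<in> (\<lambda>v. (h v, p v)) ` V \<longleftrightarrow> card {v \<in> V. (h v, p v) = y} \<noteq> 0"
          using V by (auto simp: card_eq_0_iff)
        also have "\<dots> \<longleftrightarrow> y \<in> ?hs ` S"
          unfolding fibre[OF p] using S by (auto simp: card_eq_0_iff)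
        finally show ?thesis .
      qed
      then show "(\<lambda>v. (h v, p v)) ` V = ?hs ` S" by blast
    qed (simp only: fibre[OF p])
    finally show "card (M p) = ?c" .
  qed
  finally show ?thesis by simp
qed

section \<open>The exchange argument and the number of acyclic bijections\<close>

lemma sum_of_bool_swap_invariant:
  fixes A B :: "'a \<Rightarrow> bool"
  assumes "finite X" "\<And>x. x \<in> X \<Longrightarrow> \<phi> x \<in> X" "\<And>x. x \<in> X \<Longrightarrow> \<phi> (\<phi> x) = x"
    and "\<And>x. x \<in> X \<Longrightarrow> of_bool (A x) + of_bool (A (\<phi> x)) = of_bool (B x) + (of_bool (B (\<phi> x)) :: nat)"
  shows "card {x \<in> X. A x} = card {x \<in> X. B x}"
proof -
  have bij: "bij_betw \<phi> X X" using assms by (intro bij_betw_byWitness[where f' = \<phi>]) auto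
  have double: "(\<Sum>x\<in>X. of_bool (P x) + of_bool (P (\<phi> x))) = 2 * card {x \<in> X. P x}" for P
    using sum.reindex_bij_betw[OF bij, of "\<lambda>x. of_bool (P x) :: nat"] assms(1)
    by (simp add: sum.distrib Int_def)
  have "2 * card {x \<in> X. A x} = 2 * card {x \<in> X. B x}"
    unfolding double[symmetric] using assms(4) by (rule sum.cong[OF refl])
  then show ?thesis by simp
qed

text \<open>The merging step at the level of choices. On the right, the first factor counts the
  slots \<open>s\<close> of the class of \<open>v\<close> other than the chosen
  \<open>c (h v)\<close>, so both sides count pairs (s, c) of the same set \<open>X\<close> under
  different acyclicity conditions. Exchanging \<open>s\<close> with \<open>c (h v)\<close> is an
  involution of \<open>X\<close>, and over its two states both conditions hold equally
  often.\<close>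

lemma card_choices_contract:
  fixes own :: "'b \<Rightarrow> 'a" and h :: "'a \<Rightarrow> 'k" and hs :: "'b \<Rightarrow> 'k"
  assumes K: "finite K" "h v \<in> K" and S: "finite S"
  shows "(\<Sum>s\<in>{s \<in> S. hs s = h v \<and> own s \<noteq> v}. card {c \<in> PiE K (\<lambda>k. {t \<in> S - {s}. hs t = k}).
           acyclic_map K (\<lambda>k. h (if own (c k) = v then own s else own (c k)))}) =
         (card {s \<in> S. hs s = h v} - 1) *
           card {c \<in> PiE K (\<lambda>k. {t \<in> S. hs t = k}). acyclic_map K (\<lambda>k. h (own (c k)))}"
    (is "?lhs = ?rhs")
proof -
  define C where "C = PiE K (\<lambda>k. {t \<in> S. hs t = k})"
  define X where "X = {(s, c). s \<in> S \<and> hs s = h v \<and> c \<in> C \<and> c (h v) \<noteq> s}"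
  define A where "A = (\<lambda>(s, c). own s \<noteq> v \<and>
      acyclic_map K (\<lambda>k. h (if own (c k) = v then own s else own (c k))))"
  define B where "B = (\<lambda>(s :: 'b, c). acyclic_map K (\<lambda>k. h (own (c k))))"
  define \<phi> where "\<phi> = (\<lambda>(s :: 'b, c). (c (h v), c(h v := s)))"
  have finC: "finite C" unfolding C_def using K S by (intro finite_PiE) auto
  have finX: "finite X"
    by (rule finite_subset[OF _ finite_cartesian_product[OF S finC]]) (auto simp: X_def)
  have C_val: "c (h v) \<in> S" "hs (c (h v)) = h v" if "c \<in> C" for c
    using that K by (auto simp: C_def PiE_def Pi_def)
  have C_upd: "c(h v := s) \<in> C" if "c \<in> C" "s \<in> S" "hs s = h v" for c s
    using that K by (auto simp: C_def PiE_def Pi_def extensional_def)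

  have lhs: "?lhs = card {x \<in> X. A x}"
  proof -
    define D where "D s = PiE K (\<lambda>k. {t \<in> S - {s}. hs t = k})" for s
    have D: "D s = {c \<in> C. c (h v) \<noteq> s}" if "hs s = h v" for s
      using that K by (auto simp: D_def C_def PiE_def Pi_def)
    have "{x \<in> X. A x} = (SIGMA s:{s \<in> S. hs s = h v \<and> own s \<noteq> v}.
        {c \<in> D s. acyclic_map K (\<lambda>k. h (if own (c k) = v then own s else own (c k)))})"
      by (auto simp: X_def A_def D)
    then show ?thesis unfolding D_def[symmetric] using S finC
      by (auto simp: D intro!: card_SigmaI[symmetric])
  qed

  have rhs: "?rhs = card {x \<in> X. B x}"
  proof -
    have "{x \<in> X. B x} = prod.swap ` (SIGMA c:{c \<in> C. acyclic_map K (\<lambda>k. h (own (c k)))}.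
        {s \<in> S. hs s = h v} - {c (h v)})"
      by (auto simp: X_def B_def image_iff)
    then have "card {x \<in> X. B x} = card (SIGMA c:{c \<in> C. acyclic_map K (\<lambda>k. h (own (c k)))}.
        {s \<in> S. hs s = h v} - {c (h v)})"
      by (simp add: card_image)
    also have "\<dots> = (\<Sum>c\<in>{c \<in> C. acyclic_map K (\<lambda>k. h (own (c k)))}. card {s \<in> S. hs s = h v} - 1)"
      using S finC C_val by (subst card_SigmaI) (auto intro!: sum.cong card_Diff_singleton)
    finally show ?thesis by (simp add: C_def)
  qed

  have "card {x \<in> X. A x} = card {x \<in> X. B x}"
  proof (rule sum_of_bool_swap_invariant[where \<phi> = \<phi>])
    fix x assume "x \<in> X"
    then show "\<phi> x \<in> X" "\<phi> (\<phi> x) = x"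
      using C_val C_upd by (auto simp: X_def \<phi>_def)
  next
    fix x assume x: "x \<in> X"
    obtain s c where sc: "x = (s, c)" by (cases x)
    \<comment> \<open>The vertex \<open>v\<close> becomes an extra node \<open>None\<close>, apart
      from the node \<open>Some (h v)\<close> of its class. Condition \<open>A\<close> lets
      \<open>None\<close> point where slot \<open>s\<close> leads, condition \<open>B\<close> lets
      it point to \<open>Some (h v)\<close>; bypassing \<open>None\<close> recovers the original
      conditions. The exchange then swaps the targets of the two nodes, which is the situation of
      \<open>acyclic_map_swap\<close>.\<close>
    define \<tau> where "\<tau> t = (if own t = v then None else Some (h (own t)))" for t
    define Q where "Q c = case_option None (\<lambda>k. \<tau> (c k))" for c :: "'k \<Rightarrow> 'b"
    define R where "R = Some ` (K - {h v})"
    have N: "insert None (insert (Some (h v)) R) = insert None (Some ` K)"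
      using K by (auto simp: R_def)
    have bypass: "acyclic_map (insert None (Some ` K)) ((Q c)(None := y)) \<longleftrightarrow> y \<noteq> None \<and>
        acyclic_map K (\<lambda>k. if own (c k) = v then the y else h (own (c k)))" for c y
    proof -
      have "acyclic_map (insert None (Some ` K)) ((Q c)(None := y)) \<longleftrightarrow> y \<noteq> None \<and>
          acyclic_map (Some ` K) (\<lambda>z. if Q c z = None then y else Q c z)"
        using K by (subst acyclic_map_contract
          [where q' = "\<lambda>z. if Q c z = None then y else Q c z"]) auto
      moreover have "acyclic_map (Some ` K) (\<lambda>z. if Q c z = None then y else Q c z) \<longleftrightarrow>
          acyclic_map K (\<lambda>k. if own (c k) = v then the y else h (own (c k)))" if "y \<noteq> None"
        using that K by (intro acyclic_map_image) (auto simp: Q_def \<tau>_def)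
      ultimately show ?thesis by blast
    qed
    have A: "A (s, c) \<longleftrightarrow> acyclic_map (insert None (Some ` K)) ((Q c)(None := \<tau> s))" for s c
      unfolding bypass A_def prod.case
      by (intro conj_cong acyclic_map_cong) (auto simp: \<tau>_def split: if_splits)
    have B: "B (s, c) \<longleftrightarrow> acyclic_map (insert None (Some ` K)) ((Q c)(None := Some (h v)))" for s c
      unfolding bypass B_def by (auto intro!: acyclic_map_cong)
    have Q_upd: "(Q c)(None := y, Some (h v) := \<tau> t) = (Q (c(h v := t)))(None := y)" for y t
      by (auto simp: Q_def fun_eq_iff split: option.splits)
    show "of_bool (A x) + of_bool (A (\<phi> x)) = of_bool (B x) + (of_bool (B (\<phi> x)) :: nat)"
      unfolding sc \<phi>_def prod.case A B
      using acyclic_map_swap[of None R "Some (h v)" "Q c" "\<tau> s" "\<tau> (c (h v))",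
          unfolded N Q_upd fun_upd_triv]
      by (simp add: R_def image_iff)
  qed (rule finX)
  with lhs rhs show ?thesis by simp
qed

text \<open>The induction is on the number of vertices. The root has a class of its own, so leaving
  \<open>V\<close> and leaving the set of classes mean the same; when \<open>h\<close> is injective
  on \<open>V\<close>, passing from vertices to classes is then a mere renaming.\<close>

lemma card_acyclic_matchings:
  fixes own :: "'b \<Rightarrow> 'a" and h :: "'a \<Rightarrow> 'k" and hs :: "'b \<Rightarrow> 'k"
  assumes "finite V" "finite S" "own ` S \<subseteq> insert \<rho> V" "\<rho> \<notin> V" "h \<rho> \<notin> h ` V"
    and "\<And>k. card {v \<in> V. h v = k} = card {t \<in> S. hs t = k}"
  shows "card {g \<in> matchings V h S hs. acyclic_map V (own \<circ> g)} =
    (\<Prod>k\<in>h ` V. fact (card {v \<in> V. h v = k} - 1)) *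
    card {c \<in> PiE (h ` V) (\<lambda>k. {t \<in> S. hs t = k}). acyclic_map (h ` V) (\<lambda>k. h (own (c k)))}"
  using assms
proof (induction "card V" arbitrary: V S own)
  case 0
  then have "V = {}" by simp
  moreover from 0 have "card {t \<in> S. hs t = k} = 0" for k using \<open>V = {}\<close> by (metis (no_types) card.empty empty_Collect_eq empty_iff)
  then have "S = {}" using 0 by auto
  ultimately show ?case by (simp add: matchings_def bij_betw_def acyclic_map_def acyclic_def arcs_def Collect_conv_if)
next
  case (Suc n)
  show ?case
  proof (cases "inj_on h V")
    case True
    have fib: "{w \<in> V. h w = h v} = {v}" if "v \<in> V" for v
      using True that by (auto simp: inj_on_def)
    let ?C = "PiE (h ` V) (\<lambda>k. {t \<in> S. hs t = k})"
    have unique: "t = t'" if "t \<in> S" "t' \<in> S" "hs t = hs t'" for t t'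
    proof -
      have "card {u \<in> S. hs u = hs t} \<noteq> 0" using that Suc.prems(2) by auto
      then have "{v \<in> V. h v = hs t} \<noteq> {}" using Suc.prems(6)[of "hs t"] by (metis card.empty)
      then obtain v where "v \<in> V" "h v = hs t" by auto
      then have "card {u \<in> S. hs u = hs t} = 1"
        using Suc.prems(6)[of "hs t"] fib[of v] by simp
      then obtain x where "{u \<in> S. hs u = hs t} = {x}" by (auto simp: card_1_singleton_iff)
      moreover have "t \<in> {u \<in> S. hs u = hs t}" "t' \<in> {u \<in> S. hs u = hs t}" using that by auto
      ultimately show ?thesis by (simp only: singleton_iff)
    qed
    have hit: "hs t \<in> h ` V" if "t \<in> S" for t
    proof -
      have "card {u \<in> S. hs u = hs t} \<noteq> 0" using that Suc.prems(2) by auto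
      then have "{v \<in> V. h v = hs t} \<noteq> {}" using Suc.prems(6)[of "hs t"] by (metis card.empty)
      then show ?thesis by force
    qed
    have lift: "bij_betw (\<lambda>c. restrict (c \<circ> h) V) ?C (matchings V h S hs)"
    proof (rule bij_betw_byWitness[where f' = "\<lambda>g. restrict (g \<circ> inv_into V h) (h ` V)"], goal_cases)
      case 1
      show ?case by (auto simp: PiE_def extensional_def fun_eq_iff inv_into_into f_inv_into_f)
    next
      case 2
      show ?case using True by (auto simp: matchings_def extensional_def fun_eq_iff)
    next
      case 3
      show ?case
      proof (rule image_subsetI)
        fix c assume c: "c \<in> ?C"
        then have cS: "c (h v) \<in> S \<and> hs (c (h v)) = h v" if "v \<in> V" for v
          using that by (auto simp: PiE_def Pi_def)
        have "bij_betw (restrict (c \<circ> h) V) V S"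
          unfolding bij_betw_def
        proof
          show "inj_on (restrict (c \<circ> h) V) V"
            using cS True by (auto simp: inj_on_def) metis
          have "t \<in> (restrict (c \<circ> h) V) ` V" if t: "t \<in> S" for t
          proof -
            obtain v where v: "v \<in> V" "hs t = h v" using hit[OF t] by auto
            then have "t = c (h v)" using unique t cS by auto
            then show ?thesis using v by auto
          qed
          then show "restrict (c \<circ> h) V ` V = S" using cS by auto
        qed
        then show "restrict (c \<circ> h) V \<in> matchings V h S hs" using cS by (auto simp: matchings_def)
      qed
    next
      case 4
      show ?case using True by (auto simp: matchings_def bij_betw_def)
    qed
    have acyc: "acyclic_map V (own \<circ> restrict (c \<circ> h) V) \<longleftrightarrow>
        acyclic_map (h ` V) (\<lambda>k. h (own (c k)))" if c: "c \<in> ?C" for c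
    proof -
      have "(own \<circ> (c \<circ> h)) ` V \<subseteq> insert \<rho> V"
        using c Suc.prems(3) by (auto simp: PiE_def Pi_def)
      moreover have "inj_on h (insert \<rho> V)" using True Suc.prems by auto
      ultimately have "inj_on h (V \<union> (own \<circ> (c \<circ> h)) ` V)"
        by (elim inj_on_subset) auto
      then have "acyclic_map (h ` V) (\<lambda>k. h (own (c k))) \<longleftrightarrow> acyclic_map V (own \<circ> (c \<circ> h))"
        using Suc.prems(1) by (intro acyclic_map_image) auto
      also have "\<dots> \<longleftrightarrow> acyclic_map V (own \<circ> restrict (c \<circ> h) V)"
        by (rule acyclic_map_cong) simp
      finally show ?thesis by simp
    qed
    have "bij_betw (\<lambda>c. restrict (c \<circ> h) V)
        {c \<in> ?C. acyclic_map (h ` V) (\<lambda>k. h (own (c k)))}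
        {g \<in> matchings V h S hs. acyclic_map V (own \<circ> g)}"
      by (rule bij_betw_Collect[OF lift]) (use acyc in blast)
    from bij_betw_same_card[OF this] show ?thesis
      using fib by (simp add: prod.reindex[OF True])
  next
    case False
    then obtain v v' where v: "v \<in> V" "v' \<in> V" "v \<noteq> v'" "h v = h v'" by (auto simp: inj_on_def)
    define W where "W = V - {v}"
    have VW: "V = insert v W" "v \<notin> W" using v by (auto simp: W_def)
    \<comment> \<open>The second vertex \<open>v'\<close> keeps the class of \<open>v\<close>
      inhabited, so the choices range over the same classes before and after the merge.\<close>
    have hW: "h ` W = h ` V" using v by (auto simp: W_def)
    \<comment> \<open>Merging \<open>v\<close> into its parent: the slots of \<open>v\<close> pass
      to the owner of the slot \<open>s\<close> that \<open>v\<close> occupies.\<close>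
    define own' where "own' s t = (if own t = v then own s else own t)" for s t
    define M where "M s = {g \<in> matchings W h (S - {s}) hs. acyclic_map W (own' s \<circ> g)}" for s
    define F where "F = (\<Prod>k\<in>h ` V. fact (card {v \<in> W. h v = k} - 1) :: nat)"
    have finW: "finite W" using Suc by (simp add: W_def)
    have acyc: "acyclic_map V (own \<circ> g(v := s)) \<longleftrightarrow> own s \<noteq> v \<and> acyclic_map W (own' s \<circ> g)" for g s
      unfolding VW(1) using finW VW(2)
      by (subst acyclic_map_contract[where q' = "own' s \<circ> g"]) (auto simp: own'_def)
    have IH: "card (M s) = F * card {c \<in> PiE (h ` V) (\<lambda>k. {t \<in> S - {s}. hs t = k}).
        acyclic_map (h ` V) (\<lambda>k. h (own' s (c k)))}"
      if s: "s \<in> S" "hs s = h v" "own s \<noteq> v" for s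
    proof -
      have "own' s ` (S - {s}) \<subseteq> insert \<rho> W"
        using Suc.prems(3) s by (auto simp: own'_def W_def)
      moreover have "card {w \<in> W. h w = k} = card {t \<in> S - {s}. hs t = k}" for k
        unfolding W_def using Suc.prems s v by (intro card_fibre_remove) auto
      moreover have "n = card W" using Suc VW by simp
      ultimately show ?thesis
        using Suc.hyps(1)[of W "S - {s}" "own' s"] finW Suc.prems VW(1) unfolding hW M_def F_def
        by auto
    qed
    have "bij_betw (\<lambda>(s, g). g(v := s)) (SIGMA s:{s \<in> S. hs s = h v \<and> own s \<noteq> v}. M s)
        {g \<in> matchings V h S hs. acyclic_map V (own \<circ> g)}"
    proof -
      have "(SIGMA s:{s \<in> S. hs s = h v \<and> own s \<noteq> v}. M s) =
          {x \<in> SIGMA s:{s \<in> S. hs s = h v}. matchings W h (S - {s}) hs.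
            acyclic_map V (own \<circ> (case x of (s, g) \<Rightarrow> g(v := s)))}"
        unfolding M_def using acyc by (intro set_eqI) (simp only: mem_Sigma_iff mem_Collect_eq split_paired_all prod.case, blast)
      then show ?thesis
        using bij_betw_Collect[OF matchings_insert[OF VW(2), of S hs h]] unfolding VW(1)[symmetric]
        by fastforce
    qed
    from bij_betw_same_card[OF this]
    have "card {g \<in> matchings V h S hs. acyclic_map V (own \<circ> g)} =
        card (SIGMA s:{s \<in> S. hs s = h v \<and> own s \<noteq> v}. M s)" by simp
    also have "\<dots> = (\<Sum>s\<in>{s \<in> S. hs s = h v \<and> own s \<noteq> v}. card (M s))"
      using Suc.prems finW by (intro card_SigmaI) (auto simp: M_def finite_matchings)
    also have "\<dots> = F * (\<Sum>s\<in>{s \<in> S. hs s = h v \<and> own s \<noteq> v}.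
        card {c \<in> PiE (h ` V) (\<lambda>k. {t \<in> S - {s}. hs t = k}).
          acyclic_map (h ` V) (\<lambda>k. h (own' s (c k)))})"
      using IH by (simp add: sum_distrib_left)
    also have "\<dots> = F * (card {w \<in> V. h w = h v} - 1) *
        card {c \<in> PiE (h ` V) (\<lambda>k. {t \<in> S. hs t = k}). acyclic_map (h ` V) (\<lambda>k. h (own (c k)))}"
      using card_choices_contract[of "h ` V" h v S hs own] Suc.prems v
      unfolding own'_def by simp
    \<comment> \<open>With n vertices in the class of \<open>v\<close>, the factor of this class in
      \<open>F\<close> is (n-2)!; the n-1 supplied by \<open>card_choices_contract\<close> restores
      (n-1)!.\<close>
    also have "F * (card {w \<in> V. h w = h v} - 1) = (\<Prod>k\<in>h ` V. fact (card {v \<in> V. h v = k} - 1))"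
    proof -
      have fin: "finite (h ` V)" "h v \<in> h ` V" using Suc.prems v by auto
      have other: "{w \<in> W. h w = k} = {w \<in> V. h w = k}" if "k \<noteq> h v" for k
        using that by (auto simp: W_def)
      have "{w \<in> V. h w = h v} = insert v {w \<in> W. h w = h v}" using v by (auto simp: W_def)
      then have "card {w \<in> V. h w = h v} - 1 = card {w \<in> W. h w = h v}" using finW VW by simp
      moreover have "card {w \<in> W. h w = h v} \<noteq> 0" using v finW by (auto simp: W_def)
      ultimately have "fact (card {w \<in> V. h w = h v} - 1) =
          fact (card {w \<in> W. h w = h v} - 1) * (card {w \<in> V. h w = h v} - 1)"
        by (simp add: fact_reduce)
      then show ?thesis unfolding F_def prod.remove[OF fin] by (simp add: other)
    qed
    finally show ?thesis .
  qed
qed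

subsection \<open>Rooted trees as parent maps\<close>

definition parent_edges :: "'a set \<Rightarrow> ('a \<Rightarrow> 'a) \<Rightarrow> 'a set set" where
  "parent_edges A p = (\<lambda>v. {v, p v}) ` A"

lemma successively_snoc:
  "xs \<noteq> [] \<Longrightarrow> successively P (xs @ [x]) \<longleftrightarrow> successively P xs \<and> P (last xs) x"
  by (simp add: successively_append_iff)

lemma upath_snoc:
  assumes "upath E xs" "{last xs, z} \<in> E" "z \<notin> set xs"
  shows "upath E (xs @ [z])"
  using assms by (auto simp: upath_def successively_snoc)

lemma upath_prefix:
  assumes "upath E (xs @ ys)" "xs \<noteq> []"
  shows "upath E xs"
  using assms by (auto simp: upath_def successively_append_iff)

lemma connected_imp_upath:
  assumes "(u, v) \<in> {(x, y). {x, y} \<in> E}\<^sup>*"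
  shows "\<exists>xs. upath E xs \<and> hd xs = u \<and> last xs = v"
  using assms
proof (induction rule: rtrancl_induct)
  case base
  have "upath E [u]" by (simp add: upath_def)
  then show ?case by fastforce
next
  case (step y z)
  then obtain xs where xs: "upath E xs" "hd xs = u" "last xs = y" by auto
  show ?case
  proof (cases "z \<in> set xs")
    case True
    \<comment> \<open>If \<open>z\<close> was visited before, the path is cut off at that
      visit.\<close>
    then obtain as bs where "xs = as @ z # bs" by (auto simp: in_set_conv_decomp)
    then have "xs = (as @ [z]) @ bs" by simp
    then show ?thesis using upath_prefix[of E "as @ [z]" bs] xs by (intro exI[of _ "as @ [z]"]) (cases as; auto)
  next
    case False
    then have "upath E (xs @ [z])" using upath_snoc[OF xs(1)] xs step by auto
    then show ?thesis using xs by (intro exI[of _ "xs @ [z]"]) (auto simp: upath_def hd_append)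
  qed
qed

lemma ucycle_nth:
  assumes "ucycle E xs" "i < length xs"
  shows "{xs ! i, xs ! (Suc i mod length xs)} \<in> E"
proof (cases "Suc i = length xs")
  case True
  then have "i = length xs - 1" "xs \<noteq> []" by auto
  then have "xs ! i = last xs" "xs ! (Suc i mod length xs) = hd xs"
    using True by (simp_all add: last_conv_nth hd_conv_nth)
  then show ?thesis using assms by (simp add: ucycle_def)
next
  case False
  then show ?thesis using assms by (auto simp: ucycle_def upath_def successively_conv_nth)
qed

text \<open>The rank of \<open>v\<close> is the number of points reachable from it by at least one
  arc. Passing to \<open>p v\<close> loses at least \<open>p v\<close> itself.\<close>

lemma exists_rank:
  assumes "finite A" "acyclic_map A p"
  shows "\<exists>d :: 'a \<Rightarrow> nat. \<forall>v\<in>A. d (p v) < d v"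
proof -
  have "finite (arcs A p)" using assms(1) by (simp add: arcs_def)
  define d where "d v = card {y. (v, y) \<in> (arcs A p)\<^sup>+}" for v
  have fin: "finite {y. (v, y) \<in> (arcs A p)\<^sup>+}" for v
  proof (rule finite_subset)
    show "{y. (v, y) \<in> (arcs A p)\<^sup>+} \<subseteq> snd ` (arcs A p)\<^sup>+" by force
  qed (use \<open>finite (arcs A p)\<close> in simp)
  have "d (p v) < d v" if "v \<in> A" for v
    unfolding d_def
  proof (rule psubset_card_mono[OF fin])
    have "(v, p v) \<in> arcs A p" using that by (simp add: in_arcs_iff)
    moreover have "(p v, p v) \<notin> (arcs A p)\<^sup>+" using assms(2) by (simp add: acyclic_map_def acyclic_def)
    ultimately show "{y. (p v, y) \<in> (arcs A p)\<^sup>+} \<subset> {y. (v, y) \<in> (arcs A p)\<^sup>+}"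
      by (auto intro: trancl_into_trancl2)
  qed
  then show ?thesis by blast
qed

lemma parent_edges_cases:
  assumes "{x, y} \<in> parent_edges A p"
  obtains "x \<in> A" "y = p x" | "y \<in> A" "x = p y"
  using assms by (auto simp: parent_edges_def doubleton_eq_iff)

text \<open>Both claims rest on a rank that decreases towards the root. On a cycle, both neighbours
  of a vertex of maximal rank would have to be its parent. A path from the root that has gone from a
  parent to a child cannot return to the parent, so each of its steps leads to a child.\<close>

lemma utree_parent_edges:
  assumes V: "finite V" "\<rho> \<in> V" and p: "p \<in> V - {\<rho>} \<rightarrow> V" "acyclic_map (V - {\<rho>}) p"
  defines "E \<equiv> parent_edges (V - {\<rho>}) p"
  shows "utree V E" and "is_child E \<rho> u w \<longleftrightarrow> w \<in> V - {\<rho>} \<and> u = p w"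
proof -
  obtain d :: "'a \<Rightarrow> nat" where d: "\<And>v. v \<in> V - {\<rho>} \<Longrightarrow> d (p v) < d v"
    using exists_rank[of "V - {\<rho>}" p] V p by auto
  have edge: "{p v, v} \<in> E" if "v \<in> V - {\<rho>}" for v
    using that by (auto simp: E_def parent_edges_def insert_commute)
  \<comment> \<open>The bound on the ranks is carried along because it keeps \<open>v\<close> off
    the path to its parent, to which \<open>v\<close> is appended.\<close>
  have down: "\<exists>xs. upath E xs \<and> hd xs = \<rho> \<and> last xs = v \<and> (\<forall>x\<in>set xs. d x \<le> d v)" if "v \<in> V" for v
    using that
  proof (induction "d v" arbitrary: v rule: less_induct)
    case less
    show ?case
    proof (cases "v = \<rho>")
      case True
      then show ?thesis by (intro exI[of _ "[\<rho>]"]) (auto simp: upath_def)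
    next
      case False
      then have v: "v \<in> V - {\<rho>}" using less by simp
      then have "p v \<in> V" using p by auto
      then obtain xs where xs: "upath E xs" "hd xs = \<rho>" "last xs = p v" "\<forall>x\<in>set xs. d x \<le> d (p v)"
        using less.hyps[OF d[OF v]] by auto
      then have "v \<notin> set xs" using d[OF v] by force
      then have "upath E (xs @ [v])" using upath_snoc[OF xs(1)] edge[OF v] xs by auto
      then show ?thesis using xs d[OF v]
        by (intro exI[of _ "xs @ [v]"]) (auto simp: upath_def hd_append intro: order.trans[OF _ less_imp_le])
    qed
  qed
  let ?r = "{(x, y). {x, y} \<in> E}"
  have "sym ?r" by (auto simp: sym_def insert_commute)
  have root: "(\<rho>, v) \<in> ?r\<^sup>*" if "v \<in> V" for v
    using that
  proof (induction "d v" arbitrary: v rule: less_induct)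
    case less
    show ?case
    proof (cases "v = \<rho>")
      case False
      then have v: "v \<in> V - {\<rho>}" using less by simp
      then have "(\<rho>, p v) \<in> ?r\<^sup>*" using less.hyps[OF d[OF v]] p by auto
      then show ?thesis using edge[OF v] by (auto intro: rtrancl_into_rtrancl)
    qed simp
  qed
  have conn: "\<exists>xs. upath E xs \<and> hd xs = u \<and> last xs = v" if "u \<in> V" "v \<in> V" for u v
  proof (rule connected_imp_upath)
    have "(u, \<rho>) \<in> ?r\<^sup>*" using root[OF that(1)] sym_rtrancl[OF \<open>sym ?r\<close>] by (auto dest: symD)
    then show "(u, v) \<in> ?r\<^sup>*" using root[OF that(2)] by (rule rtrancl_trans)
  qed
  have no_cycle: "\<not> ucycle E xs" for xs
  proof
    assume c: "ucycle E xs"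
    define n where "n = length xs"
    have n: "n \<ge> 3" and dist: "distinct xs" using c by (auto simp: n_def ucycle_def upath_def)
    define M where "M = Max (d ` set xs)"
    have "M \<in> d ` set xs" unfolding M_def using n by (intro Max_in) (auto simp: n_def)
    then obtain i where i: "i < n" "d (xs ! i) = M" by (auto simp: n_def in_set_conv_nth)
    have max: "d (xs ! j) \<le> d (xs ! i)" if "j < n" for j
      unfolding i(2) M_def using that by (intro Max_ge) (auto simp: n_def)
    have parent: "xs ! j = p (xs ! i)" if j: "j < n" "{xs ! i, xs ! j} \<in> E" for j
    proof -
      have "{xs ! i, xs ! j} \<in> parent_edges (V - {\<rho>}) p" using j by (simp add: E_def)
      then show ?thesis
      proof (cases rule: parent_edges_cases)
        case 2
        then show ?thesis using d[of "xs ! j"] max[OF j(1)] by simp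
      qed simp
    qed
    define j where "j = Suc i mod n"
    define k where "k = (if i = 0 then n - 1 else i - 1)"
    have k: "k < n" "Suc k mod n = i" using i n by (auto simp: k_def)
    have j: "j < n" using n by (simp add: j_def)
    have "{xs ! i, xs ! j} \<in> E" using ucycle_nth[OF c, of i] i by (simp add: j_def n_def)
    moreover have "{xs ! i, xs ! k} \<in> E"
      using ucycle_nth[OF c, of k] k by (simp add: n_def insert_commute)
    ultimately have "xs ! j = xs ! k" using parent j k by metis
    then have "j = k" using dist j k by (simp add: nth_eq_iff_index_eq n_def)
    \<comment> \<open>The successor and the predecessor of position \<open>i\<close> would coincide
      modulo \<open>n\<close>, which is impossible for n >= 3.\<close>
    then show False using n i unfolding j_def k_def by (auto simp: mod_Suc split: if_splits)
  qed
  have E: "e \<subseteq> V \<and> card e = 2" if "e \<in> E" for e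
  proof -
    obtain v where v: "v \<in> V - {\<rho>}" "e = {v, p v}" using \<open>e \<in> E\<close> by (auto simp: E_def parent_edges_def)
    then have "p v \<noteq> v" using d[of v] by auto
    then show ?thesis using v p by (auto simp: card_insert_if)
  qed
  show "utree V E"
    unfolding utree_def using V conn no_cycle E by auto
  show "is_child E \<rho> u w \<longleftrightarrow> w \<in> V - {\<rho>} \<and> u = p w"
  proof
    assume w: "w \<in> V - {\<rho>} \<and> u = p w"
    then obtain xs where xs: "upath E xs" "hd xs = \<rho>" "last xs = u" "\<forall>x\<in>set xs. d x \<le> d u"
      using down[of u] p by auto
    then have "upath E (xs @ [w])" using w d[of w] edge[of w] by (intro upath_snoc) force+
    moreover have "xs = butlast xs @ [u]" using xs by (auto simp: upath_def)
    ultimately have "upath E (butlast xs @ [u, w])" "hd (butlast xs @ [u, w]) = \<rho>"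
      using xs(2) by (metis append.assoc append_Cons append_Nil, metis append.assoc append_Cons append_Nil hd_append2 snoc_eq_iff_butlast)
    then show "is_child E \<rho> u w" by (auto simp: is_child_def)
  next
    assume "is_child E \<rho> u w"
    then obtain xs where xs: "upath E (xs @ [u, w])" "hd (xs @ [u, w]) = \<rho>" by (auto simp: is_child_def)
    then show "w \<in> V - {\<rho>} \<and> u = p w"
    proof (induction xs arbitrary: u w rule: rev_induct)
      case Nil
      then have "{u, w} \<in> parent_edges (V - {\<rho>}) p" "u = \<rho>" by (auto simp: upath_def E_def)
      then show ?case by (cases rule: parent_edges_cases) auto
    next
      case (snoc t xs)
      have path: "upath E ((xs @ [t, u]) @ [w])" using snoc.prems by simp
      then have "upath E (xs @ [t, u])" by (rule upath_prefix) simp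
      moreover have "hd (xs @ [t, u]) = \<rho>" using snoc.prems by (cases xs) auto
      ultimately have t: "t = p u" using snoc.IH by blast
      have "{u, w} \<in> parent_edges (V - {\<rho>}) p" "t \<noteq> w" using path
        by (auto simp: upath_def successively_append_iff E_def)
      then show ?case using t by (cases rule: parent_edges_cases) auto
    qed
  qed
qed

text \<open>The parent of \<open>v\<close> is the last vertex before \<open>v\<close> on a shortest
  path from the root, so the distance decreases along \<open>p\<close>. The parent edges already
  form a tree on \<open>V\<close>; a further edge of \<open>E\<close> would close a cycle with the
  path that joins its ends in that tree.\<close>

lemma utree_obtains_parent_map:
  assumes "finite V" "\<rho> \<in> V" "utree V E"
  obtains p where "p \<in> V - {\<rho>} \<rightarrow>\<^sub>E V" "acyclic_map (V - {\<rho>}) p" "E = parent_edges (V - {\<rho>}) p"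
proof -
  define path where "path v xs \<longleftrightarrow> upath E xs \<and> hd xs = \<rho> \<and> last xs = v" for v xs
  define d where "d v = (LEAST n. \<exists>xs. path v xs \<and> length xs = n)" for v
  have E: "\<And>e. e \<in> E \<Longrightarrow> e \<subseteq> V \<and> card e = 2"
    and conn: "\<And>u v. u \<in> V \<Longrightarrow> v \<in> V \<Longrightarrow> \<exists>xs. upath E xs \<and> hd xs = u \<and> last xs = v"
    and no_cycle: "\<And>xs. \<not> ucycle E xs"
    using assms(3) by (auto simp: utree_def)
  have "\<exists>u. u \<in> V \<and> {v, u} \<in> E \<and> d u < d v" if v: "v \<in> V - {\<rho>}" for v
  proof -
    have "\<exists>n xs. path v xs \<and> length xs = n" using conn[of \<rho> v] v assms by (auto simp: path_def)
    from LeastI_ex[OF this] obtain xs where xs: "path v xs" "length xs = d v" unfolding d_def by blast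
    obtain ys where ys: "xs = ys @ [v]" using xs by (cases xs rule: rev_cases) (auto simp: path_def upath_def)
    have "ys \<noteq> []" using xs v ys by (auto simp: path_def)
    then have "path (last ys) ys" using xs upath_prefix[of E ys "[v]"] by (auto simp: path_def ys)
    then have "d (last ys) \<le> length ys" unfolding d_def by (intro Least_le) auto
    moreover have "{last ys, v} \<in> E" using xs \<open>ys \<noteq> []\<close>
      by (auto simp: path_def ys upath_def successively_snoc)
    ultimately show ?thesis using E[of "{last ys, v}"] xs(2) ys
      by (intro exI[of _ "last ys"]) (auto simp: insert_commute)
  qed
  then obtain p0 where p0: "\<And>v. v \<in> V - {\<rho>} \<Longrightarrow> p0 v \<in> V \<and> {v, p0 v} \<in> E \<and> d (p0 v) < d v" by metis
  define p where "p = restrict p0 (V - {\<rho>})"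
  have p: "p \<in> V - {\<rho>} \<rightarrow>\<^sub>E V" "acyclic_map (V - {\<rho>}) p"
    using p0 by (auto simp: p_def intro!: acyclic_map_by_rank[of _ d] split: if_splits)
  let ?F = "parent_edges (V - {\<rho>}) p"
  have sub: "?F \<subseteq> E" using p0 by (auto simp: parent_edges_def p_def)
  have "utree V ?F" using utree_parent_edges(1)[OF assms(1,2) _ p(2)] p(1) by auto
  have "e \<in> ?F" if e: "e \<in> E" for e
  proof (rule ccontr)
    assume "e \<notin> ?F"
    obtain u v where uv: "e = {u, v}" "u \<noteq> v" using E[OF e] by (meson card_2_iff)
    then obtain xs where xs: "upath ?F xs" "hd xs = u" "last xs = v"
      using \<open>utree V ?F\<close> E[OF e] unfolding utree_def by blast
    have "upath E xs" using xs(1) sub by (auto simp: upath_def elim: successively_mono)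
    moreover have "length xs \<ge> 3"
    proof (rule ccontr)
      assume "\<not> length xs \<ge> 3"
      then consider "xs = []" | x where "xs = [x]" | x y where "xs = [x, y]"
        by (cases xs rule: remdups_adj.cases) (auto simp: not_le less_Suc_eq_le numeral_3_eq_3)
      then show False
        by cases (use xs uv \<open>e \<notin> ?F\<close> in \<open>auto simp: upath_def\<close>)
    qed
    ultimately have "ucycle E xs" using xs uv e by (auto simp: ucycle_def insert_commute)
    then show False using no_cycle by blast
  qed
  then show ?thesis using that[OF p] sub by blast
qed

subsection \<open>Slots and types\<close>

text \<open>Only classes with step 1 are mapped to a lower abscissa, and by exactly one. Hence (i,
  1) is the only class through which an orbit can get from abscissa i or more to below i, and in an
  acyclic map some orbit must do so.\<close>

lemma acyclic_level_map_iff: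
  fixes q :: "int \<times> int \<Rightarrow> int \<times> int" and r :: int
  assumes fin: "finite K" and K: "\<And>i s. (i, s) \<in> K \<Longrightarrow> 0 \<le> i \<and> i \<le> r \<and> (s = 1 \<or> s < 0)"
    and root: "(0, 1) \<notin> K" and lev: "\<And>i. 1 \<le> i \<Longrightarrow> i \<le> r \<Longrightarrow> \<exists>s. (i, s) \<in> K"
    and q: "\<And>k. k \<in> K \<Longrightarrow> q k \<in> insert (0, 1) K \<and> fst (q k) = fst k - snd k"
  shows "acyclic_map K q \<longleftrightarrow> (\<forall>i\<in>{1..r}. (i, 1) \<in> K \<and> q (i, 1) = (i - 1, 1))"
proof
  assume "acyclic_map K q"
  then have ac: "\<exists>x\<in>B. q x \<notin> B" if "B \<subseteq> K" "B \<noteq> {}" for B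
    using that acyclic_map_iff_no_closed_subset[OF fin, of q] by blast
  show "\<forall>i\<in>{1..r}. (i, 1) \<in> K \<and> q (i, 1) = (i - 1, 1)"
  proof
    fix i assume i: "i \<in> {1..r}"
    define B where "B = {k \<in> K. fst k \<ge> i}"
    have leave: "k = (i, 1)" if k: "k \<in> B" "q k \<notin> B" for k
    proof -
      have "fst (q k) < i" using k q[of k] i by (cases "q k") (auto simp: B_def)
      then show ?thesis using k q[of k] K[of "fst k" "snd k"]
        by (cases k) (auto simp: B_def)
    qed
    have "B \<noteq> {}" using lev[of i] i by (force simp: B_def)
    then obtain k where "k \<in> B" "q k \<notin> B" using ac[of B] by (auto simp: B_def)
    then have i1: "(i, 1) \<in> K" using leave[of k] by (auto simp: B_def)
    moreover have "q (i, 1) = (i - 1, 1)"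
    proof (rule ccontr)
      assume neq: "q (i, 1) \<noteq> (i - 1, 1)"
      have fst: "fst (q (i, 1)) = i - 1" using q[OF i1] by simp
      then have inK: "q (i, 1) \<in> K" using q[OF i1] neq by (cases "q (i, 1)") auto
      then have neg: "snd (q (i, 1)) < 0" using K[of "i - 1" "snd (q (i, 1))"] neq fst
        by (cases "q (i, 1)") auto
      \<comment> \<open>The image of (i, 1) would be a class of negative step, from which
        \<open>q\<close> jumps back to abscissa i or more. Added to \<open>B\<close>, it makes
        \<open>B\<close> closed.\<close>
      have "fst (q (q (i, 1))) \<ge> i" using q[OF inK] fst neg by simp
      then have "q (q (i, 1)) \<in> B" using q[OF inK] i by (cases "q (q (i, 1))") (auto simp: B_def)
      then have "q x \<in> insert (q (i, 1)) B" if "x \<in> insert (q (i, 1)) B" for x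
        using that leave[of x] by auto
      then show False using ac[of "insert (q (i, 1)) B"] inK by (auto simp: B_def)
    qed
    ultimately show "(i, 1) \<in> K \<and> q (i, 1) = (i - 1, 1)" by simp
  qed
next
  assume chain: "\<forall>i\<in>{1..r}. (i, 1) \<in> K \<and> q (i, 1) = (i - 1, 1)"
  \<comment> \<open>The classes with step 1 get ranks from 0 to \<open>r\<close>, by height. All
    others get ranks above \<open>r\<close> that fall as the abscissa grows, because
    \<open>q\<close> moves them upwards until they meet a class with step 1.\<close>
  define d where "d = (\<lambda>(i :: int, s :: int). nat (if s = 1 then i else 2 * r + 1 - i))"
  show "acyclic_map K q"
  proof (rule acyclic_map_by_rank[where d = d])
    fix k assume k: "k \<in> K"
    obtain i s where ks: "k = (i, s)" by (cases k)
    obtain j t where jt: "q k = (j, t)" by (cases "q k")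
    have *: "0 \<le> i" "i \<le> r" "s = 1 \<or> s < 0" using K[of i s] k ks by auto
    have j: "j = i - s" "(j, t) = (0, 1) \<or> 0 \<le> j \<and> j \<le> r" using q[OF k, unfolded jt] K[of j t]
      by (auto simp: ks)
    show "d (q k) < d k"
    proof (cases "s = 1")
      case True
      then have "i \<noteq> 0" using root k ks by auto
      then show ?thesis using chain * True jt ks by (auto simp: d_def)
    next
      case False
      moreover have "d (q k) = d (j, t)" "d k = d (i, s)" using jt ks by simp_all
      ultimately show ?thesis using * j by (auto simp: d_def)
    qed
  qed
qed

text \<open>The child vector is dropped from the type: a slot prescribes the abscissa and the step
  of its occupant, but not the children of the occupant.\<close>

definition vclass :: "('a \<Rightarrow> int \<times> int \<times> (int \<Rightarrow> nat)) \<Rightarrow> 'a \<Rightarrow> int \<times> int" where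
  "vclass e v = (fst (e v), fst (snd (e v)))"

text \<open>The triple \<open>(u, s, j)\<close> is the \<open>j\<close>-th place for a child of \<open>u\<close> at abscissa \<open>a(u) + s\<close>.\<close>

definition slots :: "int \<Rightarrow> 'a set \<Rightarrow> ('a \<Rightarrow> int \<times> int \<times> (int \<Rightarrow> nat)) \<Rightarrow> ('a \<times> int \<times> nat) set" where
  "slots m V e = (SIGMA u:V. SIGMA s:steps m. {..<snd (snd (e u)) s})"

definition slot_class :: "('a \<Rightarrow> int \<times> int \<times> (int \<Rightarrow> nat)) \<Rightarrow> 'a \<times> int \<times> nat \<Rightarrow> int \<times> int" where
  "slot_class e = (\<lambda>(u, s, j). (fst (e u) + s, s))"

lemma finite_steps [simp]: "finite (steps m)"
  by (simp add: steps_def)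

lemma finite_slots: "finite V \<Longrightarrow> finite (slots m V e)"
  by (simp add: slots_def)

lemma card_slots_of_owner:
  "card {t \<in> slots m V e. slot_class e t = (i, s) \<and> fst t = u} =
    (if u \<in> V \<and> s \<in> steps m \<and> i = fst (e u) + s then snd (snd (e u)) s else 0)"
proof (cases "u \<in> V \<and> s \<in> steps m \<and> i = fst (e u) + s")
  case True
  have "t \<in> slots m V e \<and> slot_class e t = (i, s) \<and> fst t = u \<longleftrightarrow>
      t \<in> (\<lambda>j. (u, s, j)) ` {..<snd (snd (e u)) s}" for t
    using True by (cases t) (auto simp: slots_def slot_class_def)
  then have "{t \<in> slots m V e. slot_class e t = (i, s) \<and> fst t = u} =
      (\<lambda>j. (u, s, j)) ` {..<snd (snd (e u)) s}" by blast
  then show ?thesis using True by (simp add: card_image inj_on_def)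
next
  case False
  then have "{t \<in> slots m V e. slot_class e t = (i, s) \<and> fst t = u} = {}"
    by (auto simp: slots_def slot_class_def)
  then show ?thesis by (simp only: False if_False card.empty)
qed

lemma card_slots_of_class:
  assumes "finite V" "s \<in> steps m"
  shows "card {t \<in> slots m V e. slot_class e t = (i, s) \<and> Q (fst t)} =
    (\<Sum>u\<in>{u \<in> V. fst (e u) = i - s \<and> Q u}. snd (snd (e u)) s)"
proof -
  have "{t \<in> slots m V e. slot_class e t = (i, s) \<and> Q (fst t)} =
      (SIGMA u:{u \<in> V. fst (e u) = i - s \<and> Q u}. SIGMA s':{s}. {..<snd (snd (e u)) s})"
    using assms(2) by (auto simp: slots_def slot_class_def)
  then show ?thesis using assms(1) by simp
qed

text \<open>The left side is the overcount of \<open>card_matchings_by_owner\<close>, the number of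
  slot assignments behind one parent map; it becomes the product of all b! in the
  denominator.\<close>

lemma prod_slots_fact:
  assumes "finite V"
  shows "(\<Prod>y\<in>(\<lambda>t. (slot_class e t, fst t)) ` slots m V e.
      fact (card {t \<in> slots m V e. (slot_class e t, fst t) = y})) =
    (\<Prod>u\<in>V. \<Prod>s\<in>steps m. fact (snd (snd (e u)) s) :: nat)"
proof -
  define \<psi> where "\<psi> = (\<lambda>(u, s). ((fst (e u) + s, s), u))"
  have inj: "inj_on \<psi> (V \<times> steps m)" by (auto simp: inj_on_def \<psi>_def)
  have card: "card {t \<in> slots m V e. (slot_class e t, fst t) = \<psi> (u, s)} = snd (snd (e u)) s"
    if "u \<in> V" "s \<in> steps m" for u s
    using card_slots_of_owner[of m V e "fst (e u) + s" s u] that by (simp add: \<psi>_def)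
  have "(\<Prod>y\<in>(\<lambda>t. (slot_class e t, fst t)) ` slots m V e.
      fact (card {t \<in> slots m V e. (slot_class e t, fst t) = y})) =
    (\<Prod>y\<in>\<psi> ` (V \<times> steps m). fact (card {t \<in> slots m V e. (slot_class e t, fst t) = y}) :: nat)"
  proof (rule prod.mono_neutral_left)
    show "(\<lambda>t. (slot_class e t, fst t)) ` slots m V e \<subseteq> \<psi> ` (V \<times> steps m)"
      by (force simp: slots_def slot_class_def \<psi>_def)
    show "\<forall>y\<in>\<psi> ` (V \<times> steps m) - (\<lambda>t. (slot_class e t, fst t)) ` slots m V e.
        fact (card {t \<in> slots m V e. (slot_class e t, fst t) = y}) = (1::nat)"
    proof
      fix y assume "y \<in> \<psi> ` (V \<times> steps m) - (\<lambda>t. (slot_class e t, fst t)) ` slots m V e"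
      then have "{t \<in> slots m V e. (slot_class e t, fst t) = y} = {}" by blast
      then show "fact (card {t \<in> slots m V e. (slot_class e t, fst t) = y}) = (1::nat)"
        by (simp only: card.empty fact_0)
    qed
  qed (use assms in simp)
  also have "\<dots> = (\<Prod>(u, s)\<in>V \<times> steps m. fact (snd (snd (e u)) s))"
    unfolding prod.reindex[OF inj] by (rule prod.cong[OF refl]) (auto simp: card simp del: prod.inject)
  also have "\<dots> = (\<Prod>u\<in>V. \<Prod>s\<in>steps m. fact (snd (snd (e u)) s))"
    by (rule prod.cartesian_product[symmetric])
  finally show ?thesis .
qed

section \<open>Distributions of types over labelled vertices\<close>

definition typings :: "'a set \<Rightarrow> ('t \<Rightarrow> nat) \<Rightarrow> ('a \<Rightarrow> 't) set" where
  "typings A F = {ty \<in> extensional A. \<forall>t. card {v \<in> A. ty v = t} = F t}"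

text \<open>A multinomial coefficient in multiplied-out form. It is
  \<open>card_matchings_by_owner\<close> with a single class: each type \<open>t\<close> owns
  \<open>F t\<close> slots, and the owner map of a bijection onto the slots is a typing.\<close>

lemma card_typings:
  assumes "finite A" "finite D" "\<And>t. t \<notin> D \<Longrightarrow> F t = 0" "card A = sum F D"
  shows "card (typings A F) * (\<Prod>t\<in>D. fact (F t)) = (fact (card A) :: nat)"
proof -
  let ?S = "SIGMA t:D. {..<F t}"
  have card: "card {x \<in> ?S. fst x = t} = F t" for t
  proof -
    have "{x \<in> ?S. fst x = t} = (\<lambda>j. (t, j)) ` {..<F t}"
      using assms(3)[of t] by (cases "t \<in> D") auto
    then show ?thesis by (simp add: card_image inj_on_def)
  qed
  have cS: "card ?S = card A" using assms by simp
  have "card (matchings A (\<lambda>_. ()) ?S (\<lambda>_. ())) =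
      (\<Prod>k\<in>(\<lambda>_. ()) ` A. fact (card {v \<in> A. () = k}))"
    using assms(1,2) cS by (intro card_matchings) auto
  also have "\<dots> = fact (card A)"
  proof (cases "A = {}")
    case False
    then have "(\<lambda>_. ()) ` A = {()}" by auto
    then show ?thesis by (simp only: prod.insert finite.emptyI prod.empty) simp
  qed simp
  finally have "fact (card A) = card {g \<in> matchings A (\<lambda>_. ()) ?S (\<lambda>_. ()). True}" by simp
  also have "\<dots> = card (typings A F) * (\<Prod>y\<in>(\<lambda>x. ((), fst x)) ` ?S. fact (card {x \<in> ?S. ((), fst x) = y}))"
    using card_matchings_by_owner[of A ?S "\<lambda>_. ()" "\<lambda>_. ()" "\<lambda>_. True" fst] assms(1,2)
    unfolding typings_def by (simp add: card del: mem_Sigma_iff)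
  also have "(\<Prod>y\<in>(\<lambda>x. ((), fst x)) ` ?S. fact (card {x \<in> ?S. ((), fst x) = y})) =
      (\<Prod>t\<in>fst ` ?S. fact (F t) :: nat)"
    by (rule prod.reindex_cong[of "\<lambda>t. ((), t)"])
      (auto simp: inj_on_def image_image card simp del: mem_Sigma_iff)
  also have "\<dots> = (\<Prod>t\<in>D. fact (F t))"
  proof (rule prod.mono_neutral_left)
    show "\<forall>t\<in>D - fst ` ?S. fact (F t) = (1::nat)"
    proof
      fix t assume "t \<in> D - fst ` ?S"
      then have "F t = 0" by (force simp: image_iff)
      then show "fact (F t) = (1::nat)" by simp
    qed
  qed (use assms in auto)
  finally show ?thesis by simp
qed

lemma typings_in:
  assumes "finite A" "ty \<in> typings A F" "v \<in> A"
  shows "F (ty v) \<noteq> 0"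
proof -
  have "card {w \<in> A. ty w = ty v} \<noteq> 0" using assms by auto
  moreover have "card {w \<in> A. ty w = ty v} = F (ty v)" using assms by (auto simp: typings_def)
  ultimately show ?thesis by simp
qed

lemma prod_typings:
  fixes G :: "'t \<Rightarrow> 'b::comm_monoid_mult"
  assumes "finite A" "finite D" "\<And>t. t \<notin> D \<Longrightarrow> F t = 0" "ty \<in> typings A F"
  shows "(\<Prod>v\<in>A. G (ty v)) = (\<Prod>t\<in>D. G t ^ F t)"
proof -
  have "(\<Prod>v\<in>A. G (ty v)) = (\<Prod>t\<in>D. \<Prod>v\<in>{v \<in> A. ty v = t}. G (ty v))"
    using assms(1,2) typings_in[OF assms(1,4)] assms(3) by (intro prod.group[symmetric]) blast+
  also have "\<dots> = (\<Prod>t\<in>D. G t ^ F t)"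
    using assms(4) by (intro prod.cong) (auto simp: typings_def)
  finally show ?thesis .
qed

lemma sum_typings:
  fixes G :: "'t \<Rightarrow> nat"
  assumes "finite A" "finite D" "\<And>t. t \<notin> D \<Longrightarrow> F t = 0" "ty \<in> typings A F"
  shows "(\<Sum>v\<in>{v \<in> A. Q (ty v)}. G (ty v)) = (\<Sum>t\<in>{t \<in> D. Q t}. F t * G t)"
proof -
  have "(\<Sum>v\<in>{v \<in> A. Q (ty v)}. G (ty v)) =
      (\<Sum>t\<in>{t \<in> D. Q t}. \<Sum>v\<in>{v \<in> {v \<in> A. Q (ty v)}. ty v = t}. G (ty v))"
    using assms(1,2) typings_in[OF assms(1,4)] assms(3) by (intro sum.group[symmetric]) (simp, simp, blast)
  also have "\<dots> = (\<Sum>t\<in>{t \<in> D. Q t}. F t * G t)"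
  proof (rule sum.cong[OF refl])
    fix t assume t: "t \<in> {t \<in> D. Q t}"
    then have "{v \<in> {v \<in> A. Q (ty v)}. ty v = t} = {v \<in> A. ty v = t}" by auto
    then show "(\<Sum>v\<in>{v \<in> {v \<in> A. Q (ty v)}. ty v = t}. G (ty v)) = F t * G t"
      using assms(4) by (simp add: typings_def)
  qed
  finally show ?thesis .
qed

lemma card_typings_fibre:
  assumes "finite A" "finite D" "\<And>t. t \<notin> D \<Longrightarrow> F t = 0" "ty \<in> typings A F"
  shows "card {v \<in> A. Q (ty v)} = (\<Sum>t\<in>{t \<in> D. Q t}. F t)"
  using sum_typings[OF assms, of "\<lambda>_. 1" Q] by simp

subsection \<open>Trees with given types\<close>

locale tree_profile =
  fixes m r :: int
    and c0 :: "int \<Rightarrow> nat"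
    and f :: "int \<Rightarrow> int \<Rightarrow> (int \<Rightarrow> nat) \<Rightarrow> nat"
  assumes m: "m \<le> 1"
    and c0: "c0 \<in> child_vectors m" "\<And>k. k \<noteq> 1 \<Longrightarrow> c0 k = 0"
    and domain: "\<And>i s c. f i s c \<noteq> 0 \<Longrightarrow> s \<in> steps m \<and> c \<in> child_vectors m"
    and finite_support: "finite {(i, s, c). f i s c \<noteq> 0}"
    and zero: "\<And>i s c. i < 0 \<or> c 0 > 0 \<Longrightarrow> f i s c = 0"
    and compatible: "\<And>i s. s \<in> steps m \<Longrightarrow>
      of_bool (i = s) * c0 s + (\<Sum>t\<in>steps m. Sum_any (\<lambda>c. c s * f (i - s) t c))
        = Sum_any (\<lambda>c. f i s c)"
    and r_largest: "\<And>i. n_level m f i > 0 \<Longrightarrow> i \<le> r"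
    and r_pos: "r \<ge> 1"
    and levels: "\<And>i. 0 \<le> i \<Longrightarrow> i \<le> r \<Longrightarrow> n_level m f i > 0"
begin

definition vecs :: "(int \<Rightarrow> nat) set" where
  "vecs = (\<lambda>(i, s, c). c) ` {(i, s, c). f i s c \<noteq> 0}"

definition mult :: "int \<times> int \<times> (int \<Rightarrow> nat) \<Rightarrow> nat" where
  "mult = (\<lambda>(i, s, c). f i s c)"

text \<open>A finite set containing every type of positive multiplicity; sums and products over
  whole types are reduced to it.\<close>

definition box :: "(int \<times> int \<times> (int \<Rightarrow> nat)) set" where
  "box = {0..r} \<times> steps m \<times> vecs"

lemma finite_vecs: "finite vecs"
  using finite_support by (simp add: vecs_def)

lemma vecs_support: "f i s c \<noteq> 0 \<Longrightarrow> c \<in> vecs"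
  by (force simp: vecs_def)

lemma Sum_any_vecs:
  fixes G :: "(int \<Rightarrow> nat) \<Rightarrow> nat"
  assumes "\<And>c. G c \<noteq> 0 \<Longrightarrow> f i s c \<noteq> 0"
  shows "Sum_any G = sum G vecs"
  using assms vecs_support by (intro Sum_any.expand_superset finite_vecs) blast

lemma n_step_eq: "n_step f i s = (\<Sum>c\<in>vecs. f i s c)"
  unfolding n_step_def by (rule Sum_any_vecs)

lemma n_level_eq: "n_level m f i = of_bool (i = 0) + (\<Sum>s\<in>steps m. n_step f i s)"
  unfolding n_level_def n_step_def ..

lemma support:
  assumes "f i s c \<noteq> 0"
  shows "i \<in> {0..r}" "s \<in> steps m" "c \<in> vecs" "c \<in> child_vectors m" "c 0 = 0"
proof -
  show s: "s \<in> steps m" and "c \<in> child_vectors m" using domain[OF assms] by auto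
  show c: "c \<in> vecs" using vecs_support[OF assms] .
  have "f i s c \<le> n_step f i s" unfolding n_step_eq using c finite_vecs by (intro member_le_sum) auto
  also have "\<dots> \<le> (\<Sum>s\<in>steps m. n_step f i s)" using s by (intro member_le_sum) auto
  finally have "n_level m f i > 0" using assms by (simp add: n_level_eq)
  then show "i \<in> {0..r}" using zero[of i c s] assms r_largest[of i] by force
  show "c 0 = 0" using zero[of i c s] assms by force
qed

lemma n_step_support:
  assumes "n_step f i s \<noteq> 0"
  shows "i \<in> {0..r}" "s \<in> steps m"
proof -
  obtain c where "f i s c \<noteq> 0" using assms unfolding n_step_eq by (meson sum.not_neutral_contains_not_neutral)
  then show "i \<in> {0..r}" "s \<in> steps m" using support by blast+
qed

lemma finite_box: "finite box"
  using finite_vecs by (simp add: box_def)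

lemma mult_outside_box: "t \<notin> box \<Longrightarrow> mult t = 0"
proof (rule ccontr)
  assume "t \<notin> box" "mult t \<noteq> 0"
  then show False using support(1-3)[of "fst t" "fst (snd t)" "snd (snd t)"]
    by (cases t) (auto simp: box_def mult_def)
qed

lemma sum_box:
  fixes G :: "int \<times> int \<times> (int \<Rightarrow> nat) \<Rightarrow> nat"
  shows "sum G box = (\<Sum>i\<in>{0..r}. \<Sum>s\<in>steps m. \<Sum>c\<in>vecs. G (i, s, c))"
  by (simp add: box_def sum.cartesian_product)

lemma sum_box_class:
  "(\<Sum>t\<in>{t \<in> box. (fst t, fst (snd t)) = (i, s)}. mult t * G (snd (snd t))) =
    (\<Sum>c\<in>vecs. f i s c * G c)"
proof (cases "i \<in> {0..r} \<and> s \<in> steps m")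
  case True
  have "{t \<in> box. (fst t, fst (snd t)) = (i, s)} = (\<lambda>c. (i, s, c)) ` vecs"
    using True by (auto simp: box_def image_iff)
  then show ?thesis by (simp add: sum.reindex inj_on_def mult_def)
next
  case False
  then have "{t \<in> box. (fst t, fst (snd t)) = (i, s)} = {}" by (auto simp: box_def)
  moreover have "f i s c = 0" for c using False support(1,2)[of i s c] by blast
  ultimately show ?thesis by (simp only: sum.empty) simp
qed

lemma sum_box_level:
  "(\<Sum>t\<in>{t \<in> box. fst t = i}. mult t * G (snd (snd t))) =
    (\<Sum>s\<in>steps m. \<Sum>c\<in>vecs. f i s c * G c)"
proof (cases "i \<in> {0..r}")
  case True
  have "{t \<in> box. fst t = i} = (\<lambda>(s, c). (i, s, c)) ` (steps m \<times> vecs)"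
    using True by (auto simp: box_def image_iff)
  then show ?thesis by (simp add: sum.reindex inj_on_def mult_def sum.cartesian_product split_def)
next
  case False
  then have "{t \<in> box. fst t = i} = {}" by (auto simp: box_def)
  moreover have "f i s c = 0" for s c using False support(1)[of i s c] by blast
  ultimately show ?thesis by (simp only: sum.empty) simp
qed

lemma n_total_eq: "n_total m f = 1 + sum mult box"
proof -
  have nonneg: "n_level m f i \<noteq> 0 \<Longrightarrow> i \<in> {0..r}" for i
  proof -
    assume "n_level m f i \<noteq> 0"
    then have "i = 0 \<or> (\<Sum>s\<in>steps m. n_step f i s) \<noteq> 0" by (auto simp: n_level_eq)
    then show "i \<in> {0..r}"
    proof
      assume "(\<Sum>s\<in>steps m. n_step f i s) \<noteq> 0"
      then obtain s where "n_step f i s \<noteq> 0" by (meson sum.not_neutral_contains_not_neutral)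
      then show ?thesis by (rule n_step_support)
    qed (use r_pos in auto)
  qed
  have "n_total m f = (\<Sum>i\<in>{0..r}. n_level m f i)"
    unfolding n_total_def by (rule Sum_any.expand_superset) (use nonneg in auto)
  also have "\<dots> = 1 + (\<Sum>i\<in>{0..r}. \<Sum>s\<in>steps m. \<Sum>c\<in>vecs. f i s c)"
    using r_pos unfolding n_level_eq n_step_eq sum.distrib by simp
  finally show ?thesis by (simp add: sum_box mult_def)
qed

text \<open>A vertex of class (0, 1) would need a parent at abscissa -1. The class is therefore free
  to serve as that of the root.\<close>

lemma n_step_root_class: "n_step f 0 1 = 0"
proof -
  have "1 \<in> steps m" by (simp add: steps_def)
  from compatible[OF this, of 0] show ?thesis by (simp add: n_step_def zero)
qed

definition classes :: "(int \<times> int) set" where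
  "classes = {(i, s). n_step f i s \<noteq> 0}"

lemma classes_subset: "classes \<subseteq> {0..r} \<times> steps m"
  using n_step_support by (auto simp: classes_def)

lemma finite_classes: "finite classes"
  using classes_subset by (rule finite_subset) simp

definition verts :: "nat set" where
  "verts = {1..n_total m f}"

text \<open>The root has no parent, so its step 1 is a convention. It places the root at the bottom
  of the chain of classes (i, 1).\<close>

definition rtype :: "nat \<Rightarrow> (nat \<Rightarrow> int \<times> int \<times> (int \<Rightarrow> nat)) \<Rightarrow> nat \<Rightarrow> int \<times> int \<times> (int \<Rightarrow> nat)" where
  "rtype \<rho> ty = ty(\<rho> := (0, 1, c0))"

text \<open>The fibre condition characterises the maps that arise from a class preserving bijection
  onto the slots by remembering only the owners, in the form produced by
  \<open>card_matchings_by_owner\<close>.\<close>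

definition parent_maps :: "nat \<Rightarrow> (nat \<Rightarrow> int \<times> int \<times> (int \<Rightarrow> nat)) \<Rightarrow> (nat \<Rightarrow> nat) set" where
  "parent_maps \<rho> ty = {p \<in> extensional (verts - {\<rho>}). acyclic_map (verts - {\<rho>}) p \<and>
     (\<forall>k u. card {v \<in> verts - {\<rho>}. vclass (rtype \<rho> ty) v = k \<and> p v = u} =
        card {t \<in> slots m verts (rtype \<rho> ty). slot_class (rtype \<rho> ty) t = k \<and> fst t = u})}"

text \<open>The sum over b of b n_1(i,1,b), indexed by child vectors; see
  \<open>Sum_any_up\<close>.\<close>

definition up_slots :: "int \<Rightarrow> nat" where
  "up_slots i = (\<Sum>c\<in>vecs. f i 1 c * c 1)"

lemma finite_verts: "finite verts"
  by (simp add: verts_def)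

section \<open>Counting parent maps for a fixed root and a fixed typing\<close>

context
  fixes \<rho> ty
  assumes \<rho>: "\<rho> \<in> verts" and ty: "ty \<in> typings (verts - {\<rho>}) mult"
begin

abbreviation "e \<equiv> rtype \<rho> ty"

lemma e_simps: "e \<rho> = (0, 1, c0)" "v \<noteq> \<rho> \<Longrightarrow> e v = ty v"
  by (auto simp: rtype_def)

lemma type_support:
  assumes "v \<in> verts - {\<rho>}"
  shows "f (fst (ty v)) (fst (snd (ty v))) (snd (snd (ty v))) \<noteq> 0"
  using typings_in[OF _ ty assms] finite_verts by (simp add: mult_def split_def)

lemma card_vclass: "card {v \<in> verts - {\<rho>}. vclass e v = k} = n_step f (fst k) (snd k)"
proof -
  have "{v \<in> verts - {\<rho>}. vclass e v = k} = {v \<in> verts - {\<rho>}. (fst (ty v), fst (snd (ty v))) = k}"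
    by (auto simp: vclass_def e_simps)
  then show ?thesis
    using card_typings_fibre[OF _ finite_box mult_outside_box ty, where Q = "\<lambda>t. (fst t, fst (snd t)) = k"]
      sum_box_class[where i = "fst k" and s = "snd k" and G = "\<lambda>_. 1"] finite_verts by (simp add: n_step_eq)
qed

lemma vclass_root: "vclass e \<rho> = (0, 1)"
  by (simp add: vclass_def e_simps)

lemma vclass_image: "vclass e ` (verts - {\<rho>}) = classes"
proof -
  have "k \<in> vclass e ` (verts - {\<rho>}) \<longleftrightarrow> card {v \<in> verts - {\<rho>}. vclass e v = k} \<noteq> 0" for k
    using finite_verts by (auto simp: card_eq_0_iff)
  then show ?thesis unfolding card_vclass by (intro set_eqI) (simp add: classes_def split_def)
qed

lemma root_class_notin: "(0, 1) \<notin> classes"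
  using n_step_root_class by (simp add: classes_def)

text \<open>Here the compatibility condition enters: its left side counts the slots offered to the
  class (i, s), with the root contributing \<open>c0 s\<close> when i = s.\<close>

lemma card_slots_class:
  "card {t \<in> slots m verts e. slot_class e t = k} = n_step f (fst k) (snd k)"
proof (cases "snd k \<in> steps m")
  case True
  obtain i s where k: "k = (i, s)" by (cases k)
  have s: "s \<in> steps m" using True k by simp
  have "card {t \<in> slots m verts e. slot_class e t = k} =
      (\<Sum>u\<in>{u \<in> verts. fst (e u) = i - s}. snd (snd (e u)) s)"
    using card_slots_of_class[OF finite_verts s, of e i "\<lambda>_. True"] by (simp add: k)
  also have "{u \<in> verts. fst (e u) = i - s} =
      (if i = s then {\<rho>} else {}) \<union> {u \<in> verts - {\<rho>}. fst (ty u) = i - s}"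
    using \<rho> by (auto simp: rtype_def)
  also have "(\<Sum>u\<in>\<dots>. snd (snd (e u)) s) =
      of_bool (i = s) * c0 s + (\<Sum>u\<in>{u \<in> verts - {\<rho>}. fst (ty u) = i - s}. snd (snd (ty u)) s)"
    using finite_verts by (subst sum.union_disjoint) (auto simp: e_simps intro!: sum.cong)
  also have "(\<Sum>u\<in>{u \<in> verts - {\<rho>}. fst (ty u) = i - s}. snd (snd (ty u)) s) =
      (\<Sum>t\<in>steps m. \<Sum>c\<in>vecs. f (i - s) t c * c s)"
    using sum_typings[OF _ finite_box mult_outside_box ty,
        where Q = "\<lambda>t. fst t = i - s" and G = "\<lambda>t. snd (snd t) s"]
      sum_box_level[where i = "i - s" and G = "\<lambda>c. c s"] finite_verts by simp
  also have "\<dots> = (\<Sum>t\<in>steps m. Sum_any (\<lambda>c. c s * f (i - s) t c))"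
    by (intro sum.cong refl, subst Sum_any_vecs) (auto simp: mult.commute)
  also have "of_bool (i = s) * c0 s + \<dots> = n_step f i s"
    unfolding n_step_def by (rule compatible[OF s])
  finally show ?thesis by (simp add: k)
next
  case False
  then have "{t \<in> slots m verts e. slot_class e t = k} = {}"
    by (auto simp: slots_def slot_class_def)
  moreover have "n_step f (fst k) (snd k) = 0" using n_step_support(2)[of "fst k" "snd k"] False by blast
  ultimately show ?thesis by (simp only: card.empty)
qed

lemma card_slots_up:
  "card {t \<in> slots m verts e. slot_class e t = (i, 1) \<and> vclass e (fst t) = (i - 1, 1)} =
    (if i = 1 then c0 1 else up_slots (i - 1))"
proof -
  have "1 \<in> steps m" by (simp add: steps_def)
  have "card {t \<in> slots m verts e. slot_class e t = (i, 1) \<and> vclass e (fst t) = (i - 1, 1)} =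
      (\<Sum>u\<in>{u \<in> verts. fst (e u) = i - 1 \<and> vclass e u = (i - 1, 1)}. snd (snd (e u)) 1)"
    using card_slots_of_class[OF finite_verts \<open>1 \<in> steps m\<close>, of e i "\<lambda>u. vclass e u = (i - 1, 1)"] .
  also have "{u \<in> verts. fst (e u) = i - 1 \<and> vclass e u = (i - 1, 1)} =
      (if i = 1 then {\<rho>} else {u \<in> verts - {\<rho>}. (fst (ty u), fst (snd (ty u))) = (i - 1, 1)})"
  proof (cases "i = 1")
    case True
    have "vclass e v \<noteq> (0, 1)" if "v \<in> verts - {\<rho>}" for v
      using vclass_image root_class_notin that by (metis imageI)
    then show ?thesis using True \<rho> by (auto simp: vclass_root) (auto simp: e_simps)
  next
    case False
    then show ?thesis by (auto simp: vclass_def rtype_def)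
  qed
  also have "(\<Sum>u\<in>\<dots>. snd (snd (e u)) 1) = (if i = 1 then c0 1 else up_slots (i - 1))"
  proof (cases "i = 1")
    case False
    have "(\<Sum>u\<in>{u \<in> verts - {\<rho>}. (fst (ty u), fst (snd (ty u))) = (i - 1, 1)}. snd (snd (e u)) 1) =
        (\<Sum>u\<in>{u \<in> verts - {\<rho>}. (fst (ty u), fst (snd (ty u))) = (i - 1, 1)}. snd (snd (ty u)) 1)"
      by (intro sum.cong) (auto simp: e_simps)
    also have "\<dots> = up_slots (i - 1)"
      using sum_typings[OF _ finite_box mult_outside_box ty,
          where Q = "\<lambda>t. (fst t, fst (snd t)) = (i - 1, 1)" and G = "\<lambda>t. snd (snd t) 1"]
        sum_box_class[where i = "i - 1" and s = 1 and G = "\<lambda>c. c 1"] finite_verts by (simp add: up_slots_def)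
    finally show ?thesis using False by simp
  qed (simp add: e_simps)
  finally show ?thesis .
qed

text \<open>Acyclicity restricts each coordinate separately: the slot chosen for (i, 1) must be
  owned by the class (i - 1, 1), all other coordinates are free. The acyclic choices again form a
  product set, and there are none if some class (i, 1) is empty.\<close>

lemma card_acyclic_choices:
  "card {c \<in> PiE classes (\<lambda>k. {t \<in> slots m verts e. slot_class e t = k}).
      acyclic_map classes (\<lambda>k. vclass e (fst (c k)))} =
    (if \<forall>i\<in>{1..r}. n_step f i 1 \<noteq> 0
     then c0 1 * (\<Prod>i\<in>{1..r - 1}. up_slots i) *
       (\<Prod>k\<in>{k \<in> classes. snd k \<noteq> 1}. n_step f (fst k) (snd k)) else 0)"
    (is "card ?C = _")
proof -
  let ?S = "\<lambda>k. {t \<in> slots m verts e. slot_class e t = k}"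
  have iff: "acyclic_map classes (\<lambda>k. vclass e (fst (c k))) \<longleftrightarrow>
      (\<forall>i\<in>{1..r}. (i, 1) \<in> classes \<and> vclass e (fst (c (i, 1))) = (i - 1, 1))"
    if c: "c \<in> PiE classes ?S" for c
  proof (rule acyclic_level_map_iff[OF finite_classes])
    show "0 \<le> i \<and> i \<le> r \<and> (s = 1 \<or> s < 0)" if "(i, s) \<in> classes" for i s
      using that classes_subset by (auto simp: steps_def)
    show "(0, 1) \<notin> classes" by (rule root_class_notin)
    show "\<exists>s. (i, s) \<in> classes" if "1 \<le> i" "i \<le> r" for i
    proof -
      have "\<exists>s\<in>steps m. n_step f i s \<noteq> 0"
      proof (rule ccontr)
        assume "\<not> (\<exists>s\<in>steps m. n_step f i s \<noteq> 0)"
        then have "(\<Sum>s\<in>steps m. n_step f i s) = 0" by simp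
        then show False using levels[of i] that by (simp add: n_level_eq)
      qed
      then show ?thesis by (auto simp: classes_def)
    qed
    fix k assume k: "k \<in> classes"
    then have "c k \<in> ?S k" using c by auto
    then have "fst (c k) \<in> verts" "slot_class e (c k) = k" by (auto simp: slots_def)
    moreover have "vclass e u \<in> insert (0, 1) classes" if "u \<in> verts" for u
      using that vclass_image vclass_root by (cases "u = \<rho>") auto
    ultimately show "vclass e (fst (c k)) \<in> insert (0, 1) classes \<and>
        fst (vclass e (fst (c k))) = fst k - snd k"
      by (cases "c k") (auto simp: slot_class_def vclass_def)
  qed
  show ?thesis
  proof (cases "\<forall>i\<in>{1..r}. n_step f i 1 \<noteq> 0")
    case False
    then have "?C = {}" using iff by (auto simp: classes_def)
    then show ?thesis using False by (simp only: card.empty if_False)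
  next
    case True
    define S' where "S' k = (if snd k = 1
      then {t \<in> slots m verts e. slot_class e t = (fst k, 1) \<and> vclass e (fst t) = (fst k - 1, 1)} else ?S k)"
      for k
    have up: "{k \<in> classes. snd k = 1} = (\<lambda>i. (i, 1)) ` {1..r}"
    proof -
      have "i \<in> {1..r}" if "(i, 1) \<in> classes" for i
      proof -
        have "i \<noteq> 0" using that root_class_notin by metis
        then show ?thesis using that classes_subset by auto
      qed
      moreover have "(i, 1) \<in> classes" if "i \<in> {1..r}" for i
        using True that by (simp add: classes_def)
      ultimately have iff: "(i, 1) \<in> classes \<longleftrightarrow> i \<in> {1..r}" for i by blast
      show ?thesis
      proof (intro set_eqI iffI)
        fix k assume "k \<in> {k \<in> classes. snd k = 1}"
        then obtain i where "k = (i, 1)" "(i, 1) \<in> classes" by (cases k) auto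
        then show "k \<in> (\<lambda>i. (i, 1)) ` {1..r}" using iff by blast
      next
        fix k :: "int \<times> int" assume "k \<in> (\<lambda>i. (i, 1)) ` {1..r}"
        then obtain i where "k = (i, 1)" "i \<in> {1..r}" by blast
        then show "k \<in> {k \<in> classes. snd k = 1}" using iff[of i] by simp
      qed
    qed
    have "?C = PiE classes S'"
    proof (intro set_eqI iffI)
      fix c assume c: "c \<in> ?C"
      then have chain: "\<forall>i\<in>{1..r}. vclass e (fst (c (i, 1))) = (i - 1, 1)" using iff by blast
      have "c k \<in> S' k" if "k \<in> classes" for k
      proof (cases "snd k = 1")
        case s: True
        then have "k \<in> (\<lambda>i. (i, 1)) ` {1..r}" unfolding up[symmetric] using that by simp
        then obtain i where i: "i \<in> {1..r}" "k = (i, 1)" by blast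
        have "c k \<in> ?S k" using c that by blast
        moreover have "vclass e (fst (c k)) = (i - 1, 1)" using chain i by blast
        ultimately show ?thesis by (simp add: S'_def i)
      qed (use c that in \<open>auto simp: S'_def\<close>)
      then show "c \<in> PiE classes S'" using c by auto
    next
      fix c assume c: "c \<in> PiE classes S'"
      have "S' k \<subseteq> ?S k" for k by (cases k) (auto simp: S'_def)
      then have "c \<in> PiE classes ?S" using c by fastforce
      moreover have "(i, 1) \<in> classes \<and> vclass e (fst (c (i, 1))) = (i - 1, 1)" if "i \<in> {1..r}" for i
      proof -
        have "(i, 1) \<in> classes" using True that by (simp add: classes_def)
        moreover from this have "c (i, 1) \<in> S' (i, 1)" using c by blast
        ultimately show ?thesis by (simp add: S'_def)
      qed
      ultimately show "c \<in> ?C" using iff by blast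
    qed
    then have "card ?C = (\<Prod>k\<in>classes. card (S' k))" using finite_classes by (simp add: card_PiE)
    also have "\<dots> = (\<Prod>k\<in>{k \<in> classes. snd k = 1}. card (S' k)) * (\<Prod>k\<in>{k \<in> classes. snd k \<noteq> 1}. card (S' k))"
      using finite_classes by (subst prod.union_disjoint[symmetric]) (auto intro!: prod.cong)
    also have "(\<Prod>k\<in>{k \<in> classes. snd k = 1}. card (S' k)) =
        (\<Prod>i\<in>{1..r}. if i = 1 then c0 1 else up_slots (i - 1))"
      unfolding up by (subst prod.reindex) (auto simp: inj_on_def S'_def card_slots_up)
    also have "\<dots> = c0 1 * (\<Prod>i\<in>{2..r}. up_slots (i - 1))"
    proof -
      \<comment> \<open>The class (1, 1) must take a slot of the root, whence \<open>c0 1\<close>.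
        For r = 0 this factor would be wrong: there the only tree is a single vertex and
        \<open>c0 1\<close> is 0.\<close>
      have "{1..r} = insert 1 {2..r}" using r_pos by auto
      then show ?thesis by (auto intro!: prod.cong)
    qed
    also have "(\<Prod>i\<in>{2..r}. up_slots (i - 1)) = (\<Prod>i\<in>{1..r - 1}. up_slots i)"
      by (rule prod.reindex_bij_witness[of _ "\<lambda>i. i + 1" "\<lambda>i. i - 1"]) auto
    also have "(\<Prod>k\<in>{k \<in> classes. snd k \<noteq> 1}. card (S' k)) =
        (\<Prod>k\<in>{k \<in> classes. snd k \<noteq> 1}. n_step f (fst k) (snd k))"
      by (rule prod.cong) (auto simp: S'_def card_slots_class)
    finally show ?thesis using True by simp
  qed
qed

text \<open>Acyclic bijections onto the slots are counted twice: grouped by parent map on the left,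
  through one slot per class on the right.\<close>

lemma card_parent_maps:
  "card (parent_maps \<rho> ty) * (\<Prod>u\<in>verts. \<Prod>s\<in>steps m. fact (snd (snd (e u)) s)) =
    (\<Prod>k\<in>classes. fact (n_step f (fst k) (snd k) - 1)) *
    (if \<forall>i\<in>{1..r}. n_step f i 1 \<noteq> 0
     then c0 1 * (\<Prod>i\<in>{1..r - 1}. up_slots i) *
       (\<Prod>k\<in>{k \<in> classes. snd k \<noteq> 1}. n_step f (fst k) (snd k)) else 0)"
proof -
  let ?V = "verts - {\<rho>}" and ?S = "slots m verts e"
  have fin: "finite ?V" "finite ?S" using finite_verts by (auto intro: finite_slots)
  have "card (parent_maps \<rho> ty) * (\<Prod>u\<in>verts. \<Prod>s\<in>steps m. fact (snd (snd (e u)) s)) =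
      card {g \<in> matchings ?V (vclass e) ?S (slot_class e). acyclic_map ?V (restrict (fst \<circ> g) ?V)}"
    unfolding parent_maps_def prod_slots_fact[OF finite_verts, symmetric]
    by (rule card_matchings_by_owner[OF fin, symmetric])
  also have "\<dots> = card {g \<in> matchings ?V (vclass e) ?S (slot_class e). acyclic_map ?V (fst \<circ> g)}"
  proof -
    have "acyclic_map ?V (restrict (fst \<circ> g) ?V) \<longleftrightarrow> acyclic_map ?V (fst \<circ> g)"
      for g :: "nat \<Rightarrow> nat \<times> int \<times> nat"
      by (rule acyclic_map_cong) simp
    then show ?thesis by simp
  qed
  also have "\<dots> = (\<Prod>k\<in>vclass e ` ?V. fact (card {v \<in> ?V. vclass e v = k} - 1)) *
      card {c \<in> PiE (vclass e ` ?V) (\<lambda>k. {t \<in> ?S. slot_class e t = k}).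
        acyclic_map (vclass e ` ?V) (\<lambda>k. vclass e (fst (c k)))}"
  proof (rule card_acyclic_matchings[OF fin])
    show "fst ` ?S \<subseteq> insert \<rho> ?V" by (auto simp: slots_def)
    show "vclass e \<rho> \<notin> vclass e ` ?V" unfolding vclass_image vclass_root by (rule root_class_notin)
    show "card {v \<in> ?V. vclass e v = k} = card {t \<in> ?S. slot_class e t = k}" for k
      by (simp only: card_vclass card_slots_class)
  qed simp
  finally show ?thesis unfolding vclass_image card_vclass card_acyclic_choices .
qed

lemma prod_child_fact:
  "(\<Prod>u\<in>verts. \<Prod>s\<in>steps m. fact (snd (snd (e u)) s)) =
    fact (c0 1) * (\<Prod>t\<in>box. (\<Prod>s\<in>steps m. fact (snd (snd t) s)) ^ mult t :: nat)"
proof -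
  have "(\<Prod>u\<in>verts. \<Prod>s\<in>steps m. fact (snd (snd (e u)) s)) =
      (\<Prod>s\<in>steps m. fact (c0 s)) * (\<Prod>v\<in>verts - {\<rho>}. \<Prod>s\<in>steps m. fact (snd (snd (ty v)) s) :: nat)"
    using prod.remove[OF finite_verts \<rho>, of "\<lambda>u. \<Prod>s\<in>steps m. fact (snd (snd (e u)) s) :: nat"]
    by (simp add: e_simps)
  also have "(\<Prod>s\<in>steps m. fact (c0 s)) = (fact (c0 1) :: nat)"
  proof -
    have "(\<Prod>s\<in>steps m. fact (c0 s)) = (\<Prod>s\<in>{1}. fact (c0 s) :: nat)"
      using c0(2) by (intro prod.mono_neutral_right) (auto simp: steps_def)
    then show ?thesis by simp
  qed
  also have "(\<Prod>v\<in>verts - {\<rho>}. \<Prod>s\<in>steps m. fact (snd (snd (ty v)) s) :: nat) =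
      (\<Prod>t\<in>box. (\<Prod>s\<in>steps m. fact (snd (snd t) s)) ^ mult t)"
    using finite_verts
    by (intro prod_typings[OF _ finite_box mult_outside_box ty,
      where G = "\<lambda>t. \<Prod>s\<in>steps m. fact (snd (snd t) s)"]) auto
  finally show ?thesis .
qed

end

section \<open>The embedded tree of a parent map\<close>

context
  fixes \<rho> ty p
  assumes \<rho>: "\<rho> \<in> verts" and ty: "ty \<in> typings (verts - {\<rho>}) mult" and p: "p \<in> parent_maps \<rho> ty"
begin

abbreviation "e' \<equiv> rtype \<rho> ty"

lemma parent_fibre:
  "card {v \<in> verts - {\<rho>}. vclass e' v = k \<and> p v = u} =
    card {t \<in> slots m verts e'. slot_class e' t = k \<and> fst t = u}"
  using p unfolding parent_maps_def by blast

lemma parent_step: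
  assumes "w \<in> verts - {\<rho>}"
  shows "p w \<in> verts" "fst (e' w) = fst (e' (p w)) + fst (snd (e' w))" "fst (snd (e' w)) \<in> steps m"
proof -
  have "card {v \<in> verts - {\<rho>}. vclass e' v = vclass e' w \<and> p v = p w} \<noteq> 0"
    using assms finite_verts by auto
  then have "card {t \<in> slots m verts e'. slot_class e' t = vclass e' w \<and> fst t = p w} \<noteq> 0"
    unfolding parent_fibre .
  then show "p w \<in> verts" "fst (e' w) = fst (e' (p w)) + fst (snd (e' w))" "fst (snd (e' w)) \<in> steps m"
    unfolding vclass_def card_slots_of_owner by (simp_all split: if_splits)
qed

lemma card_children:
  assumes u: "u \<in> verts" and k: "k \<in> {m..1}"
  shows "card {w \<in> verts - {\<rho>}. p w = u \<and> fst (e' w) = fst (e' u) + k} = snd (snd (e' u)) k"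
proof (cases "k = 0")
  \<comment> \<open>Step 0 is not allowed, so no child shares the abscissa of its parent;
    correspondingly every type that occurs has 0-component 0.\<close>
  case True
  have "0 \<notin> steps m" by (simp add: steps_def)
  then have "{w \<in> verts - {\<rho>}. p w = u \<and> fst (e' w) = fst (e' u) + k} = {}"
    using parent_step True by fastforce
  moreover have "snd (snd (e' u)) 0 = 0"
  proof (cases "u = \<rho>")
    case True
    then show ?thesis using c0 by (simp add: rtype_def)
  next
    case False
    then show ?thesis using support(5)[OF type_support[OF \<rho> ty, of u]] u by (simp add: rtype_def)
  qed
  ultimately show ?thesis by (simp only: True card.empty)
next
  case False
  then have "k \<in> steps m" using k by (auto simp: steps_def)
  moreover have "{w \<in> verts - {\<rho>}. p w = u \<and> fst (e' w) = fst (e' u) + k} =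
      {w \<in> verts - {\<rho>}. vclass e' w = (fst (e' u) + k, k) \<and> p w = u}"
    using parent_step(2) by (force simp: vclass_def)
  moreover have "card {w \<in> verts - {\<rho>}. vclass e' w = (fst (e' u) + k, k) \<and> p w = u} =
      card {t \<in> slots m verts e'. slot_class e' t = (fst (e' u) + k, k) \<and> fst t = u}"
    by (rule parent_fibre)
  ultimately show ?thesis using u unfolding card_slots_of_owner by simp
qed

abbreviation "edges \<equiv> parent_edges (verts - {\<rho>}) p"
abbreviation "absc \<equiv> restrict (\<lambda>v. fst (e' v)) verts"

lemma edges_tree:
  "utree verts edges" "is_child edges \<rho> u w \<longleftrightarrow> w \<in> verts - {\<rho>} \<and> u = p w"
proof -
  have "p \<in> verts - {\<rho>} \<rightarrow> verts" "acyclic_map (verts - {\<rho>}) p"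
    using parent_step(1) p by (auto simp: parent_maps_def)
  from utree_parent_edges[OF finite_verts \<rho> this]
  show "utree verts edges" "is_child edges \<rho> u w \<longleftrightarrow> w \<in> verts - {\<rho>} \<and> u = p w" by auto
qed

lemma has_in_type_iff:
  assumes "u \<in> verts"
  shows "has_in_type m edges \<rho> absc u i c \<longleftrightarrow>
    fst (e' u) = i \<and> (\<forall>k\<in>{m..1}. snd (snd (e' u)) k = c k)"
proof -
  have "{w. is_child edges \<rho> u w \<and> absc w = fst (e' u) + k} =
      {w \<in> verts - {\<rho>}. p w = u \<and> fst (e' w) = fst (e' u) + k}" for k
    unfolding edges_tree by auto
  then have card: "card {w. is_child edges \<rho> u w \<and> absc w = fst (e' u) + k} = snd (snd (e' u)) k"
    if "k \<in> {m..1}" for k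
    using card_children[OF assms that] by simp
  have "(\<forall>k\<in>{m..1}. card {w. is_child edges \<rho> u w \<and> absc w = fst (e' u) + k} = c k) \<longleftrightarrow>
      (\<forall>k\<in>{m..1}. snd (snd (e' u)) k = c k)"
    by (intro ball_cong refl) (simp only: card)
  moreover have "absc u = fst (e' u)" using assms by simp
  ultimately show ?thesis unfolding has_in_type_def
    by (cases "fst (e' u) = i") (simp_all only: simp_thms)
qed

lemma has_type_iff:
  assumes v: "v \<in> verts - {\<rho>}" and c: "c \<in> child_vectors m"
  shows "has_type m edges \<rho> absc v i s c \<longleftrightarrow> ty v = (i, s, c)"
proof -
  have ev: "e' v = ty v" using v by (simp add: rtype_def)
  have tv: "snd (snd (ty v)) \<in> child_vectors m"
    using support(4)[OF type_support[OF \<rho> ty v]] .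
  have eq: "(\<forall>k\<in>{m..1}. snd (snd (ty v)) k = c k) \<longleftrightarrow> snd (snd (ty v)) = c"
  proof
    assume a: "\<forall>k\<in>{m..1}. snd (snd (ty v)) k = c k"
    show "snd (snd (ty v)) = c"
    proof
      fix k show "snd (snd (ty v)) k = c k"
        using a tv c by (cases "k \<in> {m..1}") (simp_all add: child_vectors_def)
    qed
  qed simp
  have "(\<exists>u. is_child edges \<rho> u v \<and> absc u = i - s) \<longleftrightarrow> fst (e' (p v)) = i - s"
    using v parent_step(1)[OF v] by (auto simp: edges_tree)
  then have "has_type m edges \<rho> absc v i s c \<longleftrightarrow>
      fst (ty v) = i \<and> snd (snd (ty v)) = c \<and> fst (e' (p v)) = i - s"
    unfolding has_type_def using has_in_type_iff[of v] v eq ev by auto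
  also have "\<dots> \<longleftrightarrow> ty v = (i, s, c)"
    using parent_step(2)[OF v] ev by (cases "ty v") auto
  finally show ?thesis .
qed

lemma tree_in_trees_of_type: "(edges, \<rho>, absc) \<in> trees_of_type m c0 f (n_total m f)"
proof -
  have "absc w - absc v \<in> steps m" if "w \<in> verts - {\<rho>}" "v = p w" for v w
    using parent_step[OF that(1)] that by simp
  then have "(edges, \<rho>, absc) \<in> embedded_cayley_trees (steps m) (n_total m f)"
    unfolding embedded_cayley_trees_def verts_def[symmetric]
    using edges_tree \<rho> by (auto simp: rtype_def)
  moreover have "has_in_type m edges \<rho> absc \<rho> 0 c0"
    using has_in_type_iff[OF \<rho>] by (simp add: rtype_def)
  moreover have "card {v \<in> verts - {\<rho>}. has_type m edges \<rho> absc v i s c} = f i s c"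
    if "c \<in> child_vectors m" for i s c
  proof -
    have "{v \<in> verts - {\<rho>}. has_type m edges \<rho> absc v i s c} = {v \<in> verts - {\<rho>}. ty v = (i, s, c)}"
      using has_type_iff[OF _ that] by auto
    then show ?thesis using ty by (simp add: typings_def mult_def)
  qed
  ultimately show ?thesis by (simp add: trees_of_type_def verts_def)
qed

end

section \<open>The correspondence between trees and typed parent maps\<close>

definition tree_of :: "nat \<times> (nat \<Rightarrow> int \<times> int \<times> (int \<Rightarrow> nat)) \<times> (nat \<Rightarrow> nat) \<Rightarrow>
    nat set set \<times> nat \<times> (nat \<Rightarrow> int)" where
  "tree_of = (\<lambda>(\<rho>, ty, p).
     (parent_edges (verts - {\<rho>}) p, \<rho>, restrict (\<lambda>v. fst (rtype \<rho> ty v)) verts))"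

definition typed_parent_maps ::
    "(nat \<times> (nat \<Rightarrow> int \<times> int \<times> (int \<Rightarrow> nat)) \<times> (nat \<Rightarrow> nat)) set" where
  "typed_parent_maps =
     (SIGMA \<rho>:verts. SIGMA ty:typings (verts - {\<rho>}) mult. parent_maps \<rho> ty)"

text \<open>The child relation of the tree determines \<open>p\<close>, and the predicate
  \<open>has_type\<close> recovers the type of each non-root vertex.\<close>

lemma inj_on_tree_of: "inj_on tree_of typed_parent_maps"
proof (rule inj_onI)
  fix x y assume x: "x \<in> typed_parent_maps" and y: "y \<in> typed_parent_maps" and eq: "tree_of x = tree_of y"
  obtain \<rho> ty p where xd: "x = (\<rho>, ty, p)" by (cases x)
  obtain \<rho>' ty' p' where yd: "y = (\<rho>', ty', p')" by (cases y)
  have \<rho>': "\<rho>' = \<rho>" using eq by (simp add: xd yd tree_of_def)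
  have X: "\<rho> \<in> verts" "ty \<in> typings (verts - {\<rho>}) mult" "p \<in> parent_maps \<rho> ty"
    using x by (auto simp: xd typed_parent_maps_def)
  have Y: "\<rho> \<in> verts" "ty' \<in> typings (verts - {\<rho>}) mult" "p' \<in> parent_maps \<rho> ty'"
    using y \<rho>' by (auto simp: yd typed_parent_maps_def)
  have E: "parent_edges (verts - {\<rho>}) p = parent_edges (verts - {\<rho>}) p'"
    and A: "restrict (\<lambda>v. fst (rtype \<rho> ty v)) verts = restrict (\<lambda>v. fst (rtype \<rho> ty' v)) verts"
    using eq \<rho>' by (auto simp: xd yd tree_of_def)
  have "p w = p' w" if w: "w \<in> verts - {\<rho>}" for w
    using edges_tree(2)[OF X, of "p w" w] edges_tree(2)[OF Y, of "p w" w] w unfolding E by blast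
  moreover have "p \<in> extensional (verts - {\<rho>})" "p' \<in> extensional (verts - {\<rho>})"
    using X Y by (auto simp: parent_maps_def)
  ultimately have "p = p'" by (metis extensionalityI)
  moreover have "ty v = ty' v" if v: "v \<in> verts - {\<rho>}" for v
  proof -
    obtain i s c where t: "ty v = (i, s, c)" by (cases "ty v")
    have c: "c \<in> child_vectors m" using support(4)[OF type_support[OF X(1,2) v]] t by simp
    show ?thesis
      using has_type_iff[OF X v c, of i s] has_type_iff[OF Y v c, of i s] t unfolding E A by simp
  qed
  then have "ty = ty'" using X(2) Y(2) by (intro extensionalityI[of _ "verts - {\<rho>}"]) (auto simp: typings_def)
  ultimately show "x = y" by (simp add: xd yd \<rho>')
qed

lemma tree_of_surj:
  assumes "T \<in> trees_of_type m c0 f (n_total m f)"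
  shows "T \<in> tree_of ` typed_parent_maps"
proof -
  obtain E \<rho> a where T: "T = (E, \<rho>, a)" by (cases T)
  have tree: "utree verts E" and \<rho>: "\<rho> \<in> verts" and a: "a \<in> extensional verts" "a \<rho> = 0"
    and step: "\<And>v w. v \<in> verts \<Longrightarrow> w \<in> verts \<Longrightarrow> is_child E \<rho> v w \<Longrightarrow> a w - a v \<in> steps m"
    and root: "has_in_type m E \<rho> a \<rho> 0 c0"
    and types: "\<And>i s c. s \<in> steps m \<Longrightarrow> c \<in> child_vectors m \<Longrightarrow>
      card {v \<in> verts - {\<rho>}. has_type m E \<rho> a v i s c} = f i s c"
    using assms unfolding T trees_of_type_def embedded_cayley_trees_def verts_def by auto
  obtain p where p: "p \<in> verts - {\<rho>} \<rightarrow>\<^sub>E verts" "acyclic_map (verts - {\<rho>}) p"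
    and E: "E = parent_edges (verts - {\<rho>}) p"
    using utree_obtains_parent_map[OF finite_verts \<rho> tree] .
  have "p \<in> verts - {\<rho>} \<rightarrow> verts" using p(1) by auto
  note child = utree_parent_edges(2)[OF finite_verts \<rho> this p(2), folded E]
  \<comment> \<open>Cutting off to 0 outside {m..1} makes \<open>cv v\<close> a child vector, so
    that agreement on {m..1} amounts to equality of functions.\<close>
  define cv where "cv v k = (if k \<in> {m..1} then card {w \<in> verts - {\<rho>}. p w = v \<and> a w = a v + k} else 0)"
    for v k
  define ty where "ty = restrict (\<lambda>v. (a v, a v - a (p v), cv v)) (verts - {\<rho>})"
  have cv: "cv v \<in> child_vectors m" for v by (auto simp: cv_def child_vectors_def)
  have pv: "p v \<in> verts" if "v \<in> verts - {\<rho>}" for v using p(1) that by auto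
  have stepv: "a v - a (p v) \<in> steps m" if "v \<in> verts - {\<rho>}" for v
    using step[of "p v" v] child[of "p v" v] that pv by simp
  have set: "{w. is_child E \<rho> v w \<and> a w = j} = {w \<in> verts - {\<rho>}. p w = v \<and> a w = j}" for v j
    unfolding child by auto
  have has_type: "has_type m E \<rho> a v i s c \<longleftrightarrow> ty v = (i, s, c)"
    if v: "v \<in> verts - {\<rho>}" and c: "c \<in> child_vectors m" for v i s c
  proof -
    have "has_type m E \<rho> a v i s c \<longleftrightarrow> a v = i \<and> (\<forall>k\<in>{m..1}. cv v k = c k) \<and> a (p v) = i - s"
      unfolding has_type_def has_in_type_def set unfolding child using v by (auto simp: cv_def)
    also have "(\<forall>k\<in>{m..1}. cv v k = c k) \<longleftrightarrow> cv v = c"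
    proof
      assume h: "\<forall>k\<in>{m..1}. cv v k = c k"
      show "cv v = c"
      proof
        fix k show "cv v k = c k"
          using h cv[of v] c by (cases "k \<in> {m..1}") (simp_all add: child_vectors_def)
      qed
    qed simp
    finally show ?thesis using v by (auto simp: ty_def)
  qed
  have "card {v \<in> verts - {\<rho>}. ty v = t} = mult t" for t
  proof -
    obtain i s c where t: "t = (i, s, c)" by (cases t)
    show ?thesis
    proof (cases "s \<in> steps m \<and> c \<in> child_vectors m")
      case True
      then have "{v \<in> verts - {\<rho>}. ty v = t} = {v \<in> verts - {\<rho>}. has_type m E \<rho> a v i s c}"
        using has_type by (auto simp: t)
      then show ?thesis using types[of s c i] True by (simp add: t mult_def)
    next
      \<comment> \<open>The definition of \<open>trees_of_type\<close> does not constrain these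
        triples; no vertex has such a type, and \<open>domain\<close> forces the prescribed number
        to be 0.\<close>
      case False
      then have "{v \<in> verts - {\<rho>}. ty v = t} = {}" using stepv cv by (auto simp: t ty_def)
      moreover have "mult t = 0" using False domain[of i s c] by (auto simp: mult_def t)
      ultimately show ?thesis by (simp only: card.empty)
    qed
  qed
  then have ty: "ty \<in> typings (verts - {\<rho>}) mult" by (simp add: typings_def ty_def)
  have lev: "fst (rtype \<rho> ty v) = a v" if "v \<in> verts" for v
    using that a(2) by (auto simp: rtype_def ty_def)
  have vec: "snd (snd (rtype \<rho> ty u)) s = card {w \<in> verts - {\<rho>}. p w = u \<and> a w = a u + s}"
    if "u \<in> verts" "s \<in> {m..1}" for u s
  proof (cases "u = \<rho>")
    case True
    then show ?thesis using root that a(2) unfolding has_in_type_def set by (simp add: rtype_def)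
  next
    case False
    then show ?thesis using that by (simp add: rtype_def ty_def cv_def)
  qed
  have "card {v \<in> verts - {\<rho>}. vclass (rtype \<rho> ty) v = k \<and> p v = u} =
      card {t \<in> slots m verts (rtype \<rho> ty). slot_class (rtype \<rho> ty) t = k \<and> fst t = u}" for k u
  proof -
    obtain i s where k: "k = (i, s)" by (cases k)
    have vc: "vclass (rtype \<rho> ty) v = (a v, a v - a (p v))" if "v \<in> verts - {\<rho>}" for v
      using that by (simp add: vclass_def rtype_def ty_def)
    show ?thesis
    proof (cases "u \<in> verts \<and> s \<in> steps m \<and> i = a u + s")
      case True
      then have "{v \<in> verts - {\<rho>}. vclass (rtype \<rho> ty) v = k \<and> p v = u} =
          {v \<in> verts - {\<rho>}. p v = u \<and> a v = a u + s}" using vc by (auto simp: k)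
      moreover have "s \<in> {m..1}" using True m by (auto simp: steps_def)
      ultimately show ?thesis using True vec[of u s] lev[of u] unfolding k card_slots_of_owner by simp
    next
      case False
      then have "{v \<in> verts - {\<rho>}. vclass (rtype \<rho> ty) v = k \<and> p v = u} = {}"
        using vc pv stepv by (auto simp: k)
      moreover have "\<not> (u \<in> verts \<and> s \<in> steps m \<and> i = fst (rtype \<rho> ty u) + s)"
        using False lev by metis
      ultimately show ?thesis unfolding k card_slots_of_owner by (simp only: card.empty if_False)
    qed
  qed
  then have "p \<in> parent_maps \<rho> ty" using p by (auto simp: parent_maps_def PiE_def)
  then have "(\<rho>, ty, p) \<in> typed_parent_maps" using \<rho> ty by (simp add: typed_parent_maps_def)
  moreover have "tree_of (\<rho>, ty, p) = T"
    using lev a(1) E by (auto simp: tree_of_def T restrict_def extensional_def fun_eq_iff)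
  ultimately show ?thesis by (metis imageI)
qed

lemma card_trees_of_type: "card (trees_of_type m c0 f (n_total m f)) = card typed_parent_maps"
proof -
  have "tree_of ` typed_parent_maps = trees_of_type m c0 f (n_total m f)"
    using tree_of_surj tree_in_trees_of_type by (auto simp: typed_parent_maps_def tree_of_def)
  then show ?thesis using card_image[OF inj_on_tree_of] by simp
qed

subsection \<open>The enumeration\<close>

text \<open>The number of acyclic bijections onto the slots; it depends neither on the root nor on
  the typing.\<close>

definition tree_weight :: nat where
  "tree_weight = (\<Prod>k\<in>classes. fact (n_step f (fst k) (snd k) - 1)) *
    (if \<forall>i\<in>{1..r}. n_step f i 1 \<noteq> 0
     then c0 1 * (\<Prod>i\<in>{1..r - 1}. up_slots i) *
       (\<Prod>k\<in>{k \<in> classes. snd k \<noteq> 1}. n_step f (fst k) (snd k)) else 0)"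

definition child_fact :: nat where
  "child_fact = fact (c0 1) * (\<Prod>t\<in>box. (\<Prod>s\<in>steps m. fact (snd (snd t) s)) ^ mult t)"

lemma child_fact_pos: "child_fact > 0"
  by (auto simp: child_fact_def intro!: prod_pos)

text \<open>There are n roots, for each of them (n-1)! / (product of all f!) typings, and for each
  typing \<open>tree_weight\<close> / \<open>child_fact\<close> parent maps. The equation is
  multiplied out to stay within the natural numbers.\<close>

lemma card_trees_times:
  "card (trees_of_type m c0 f (n_total m f)) * child_fact * (\<Prod>t\<in>box. fact (mult t)) =
    fact (n_total m f) * tree_weight"
proof -
  have pm: "card (parent_maps \<rho> ty) = tree_weight div child_fact"
    and dvd: "child_fact dvd tree_weight"
    if "\<rho> \<in> verts" "ty \<in> typings (verts - {\<rho>}) mult" for \<rho> ty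
  proof -
    have "tree_weight = card (parent_maps \<rho> ty) * child_fact"
      using card_parent_maps[OF that] prod_child_fact[OF that]
      by (simp add: child_fact_def tree_weight_def)
    then show "card (parent_maps \<rho> ty) = tree_weight div child_fact" "child_fact dvd tree_weight"
      using child_fact_pos by simp_all
  qed
  have fin_pm: "finite (parent_maps \<rho> ty)" if "\<rho> \<in> verts" "ty \<in> typings (verts - {\<rho>}) mult" for \<rho> ty
  proof (rule finite_subset)
    show "parent_maps \<rho> ty \<subseteq> PiE (verts - {\<rho>}) (\<lambda>_. verts)"
      using parent_step(1)[OF that] by (auto simp: parent_maps_def PiE_def)
    show "finite (PiE (verts - {\<rho>}) (\<lambda>_. verts))" using finite_verts by (intro finite_PiE) auto
  qed
  have card_V: "card (verts - {\<rho>}) = sum mult box" if "\<rho> \<in> verts" for \<rho>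
    using that n_total_eq by (simp add: verts_def)
  have fin_ty: "finite (typings (verts - {\<rho>}) mult)" if "\<rho> \<in> verts" for \<rho>
  proof (rule finite_subset)
    show "typings (verts - {\<rho>}) mult \<subseteq> PiE (verts - {\<rho>}) (\<lambda>_. box)"
    proof
      fix ty assume ty: "ty \<in> typings (verts - {\<rho>}) mult"
      have "ty v \<in> box" if "v \<in> verts - {\<rho>}" for v
        using typings_in[OF finite_Diff[OF finite_verts] ty that] mult_outside_box[of "ty v"] by auto
      then show "ty \<in> PiE (verts - {\<rho>}) (\<lambda>_. box)" using ty by (auto simp: typings_def PiE_def)
    qed
    show "finite (PiE (verts - {\<rho>}) (\<lambda>_. box))" using finite_verts finite_box by (intro finite_PiE) auto
  qed
  have ty: "card (typings (verts - {\<rho>}) mult) * (\<Prod>t\<in>box. fact (mult t)) = fact (sum mult box)"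
    if "\<rho> \<in> verts" for \<rho>
    using card_typings[OF _ finite_box mult_outside_box card_V[OF that]] finite_verts card_V[OF that] by simp
  have per_root: "card (SIGMA ty:typings (verts - {\<rho>}) mult. parent_maps \<rho> ty) * child_fact *
      (\<Prod>t\<in>box. fact (mult t)) = fact (sum mult box) * tree_weight" if \<rho>: "\<rho> \<in> verts" for \<rho>
  proof -
    have "card (SIGMA ty:typings (verts - {\<rho>}) mult. parent_maps \<rho> ty) =
        card (typings (verts - {\<rho>}) mult) * (tree_weight div child_fact)"
      using fin_ty[OF \<rho>] fin_pm[OF \<rho>] pm[OF \<rho>] by (subst card_SigmaI) auto
    moreover have "(tree_weight div child_fact) * child_fact = tree_weight"
      if "typings (verts - {\<rho>}) mult \<noteq> {}"
      using that dvd[OF \<rho>] by fastforce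
    \<comment> \<open>A typing must exist because divisibility of \<open>tree_weight\<close> by
      \<open>child_fact\<close> is derived from the count of parent maps for some typing.\<close>
    moreover have "typings (verts - {\<rho>}) mult \<noteq> {}"
    proof
      assume "typings (verts - {\<rho>}) mult = {}"
      then show False using ty[OF \<rho>] by simp
    qed
    ultimately have "card (SIGMA ty:typings (verts - {\<rho>}) mult. parent_maps \<rho> ty) * child_fact =
        card (typings (verts - {\<rho>}) mult) * tree_weight" by (simp add: mult.assoc)
    then show ?thesis using ty[OF \<rho>] by (simp add: ac_simps)
  qed
  have "card typed_parent_maps =
      (\<Sum>\<rho>\<in>verts. card (SIGMA ty:typings (verts - {\<rho>}) mult. parent_maps \<rho> ty))"
    unfolding typed_parent_maps_def using finite_verts fin_ty fin_pm
    by (intro card_SigmaI) (auto intro!: finite_SigmaI)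
  then have "card typed_parent_maps * child_fact * (\<Prod>t\<in>box. fact (mult t)) =
      (\<Sum>\<rho>\<in>verts. fact (sum mult box) * tree_weight)"
    using per_root by (simp add: sum_distrib_right)
  also have "\<dots> = fact (n_total m f) * tree_weight"
    by (simp add: verts_def n_total_eq algebra_simps)
  finally show ?thesis by (simp add: card_trees_of_type)
qed

text \<open>Each class with step other than 1 contributes (n_k - 1)! n_k = n_k!. The classes (i, 1)
  lack the factor n(i,1), which is the origin of the product in the denominator.\<close>

lemma tree_weight_eq:
  "real tree_weight = real (c0 1) * (\<Prod>k\<in>classes. fact (n_step f (fst k) (snd k))) /
    (\<Prod>i\<in>{1..r}. real (n_step f i 1)) * (\<Prod>i\<in>{1..r - 1}. real (up_slots i))"
proof (cases "\<forall>i\<in>{1..r}. n_step f i 1 \<noteq> 0")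
  case False
  \<comment> \<open>The denominator vanishes, so the right side is 0 by the convention for division,
    in agreement with the absence of trees.\<close>
  then have "(\<Prod>i\<in>{1..r}. real (n_step f i 1)) = 0" by auto
  moreover have "tree_weight = 0" using False unfolding tree_weight_def by (simp only: if_False mult_0_right)
  ultimately show ?thesis by simp
next
  case True
  define N where "N k = n_step f (fst k) (snd k)" for k
  have split: "(\<Prod>k\<in>classes. N k) =
      (\<Prod>k\<in>{k \<in> classes. snd k = 1}. N k) * (\<Prod>k\<in>{k \<in> classes. snd k \<noteq> 1}. N k)"
    using finite_classes by (subst prod.union_disjoint[symmetric]) (auto intro!: prod.cong)
  have "(\<Prod>k\<in>{k \<in> classes. snd k = 1}. N k) = (\<Prod>i\<in>{1..r}. n_step f i 1)"
  proof (rule prod.reindex_bij_witness[of _ "\<lambda>i. (i, 1)" fst])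
    fix k assume k: "k \<in> {k \<in> classes. snd k = 1}"
    then show "(fst k, 1) = k" by (cases k) auto
    have "fst k \<noteq> 0" using k n_step_root_class by (cases k) (auto simp: classes_def)
    moreover have "fst k \<in> {0..r}" using k classes_subset by auto
    ultimately show "fst k \<in> {1..r}" by auto
    show "n_step f (fst k) 1 = N k" using k by (simp add: N_def)
  next
    fix i assume "i \<in> {1..r}"
    then show "(i, 1) \<in> {k \<in> classes. snd k = 1}" using True by (simp add: classes_def)
  qed simp
  moreover have "fact (N k) = fact (N k - 1) * N k" if "k \<in> classes" for k
    using that by (simp add: N_def classes_def split_def fact_reduce)
  then have "(\<Prod>k\<in>classes. fact (N k)) = (\<Prod>k\<in>classes. fact (N k - 1)) * (\<Prod>k\<in>classes. N k)"
    by (simp add: prod.distrib)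
  ultimately have key: "(\<Prod>k\<in>classes. fact (N k)) =
      (\<Prod>k\<in>classes. fact (N k - 1)) * (\<Prod>k\<in>{k \<in> classes. snd k \<noteq> 1}. N k) *
      (\<Prod>i\<in>{1..r}. n_step f i 1)"
    by (simp add: split)
  have "real (\<Prod>k\<in>classes. fact (N k)) = (\<Prod>k\<in>classes. fact (N k))" by simp
  then have key': "(\<Prod>k\<in>classes. fact (N k)) =
      real ((\<Prod>k\<in>classes. fact (N k - 1)) * (\<Prod>k\<in>{k \<in> classes. snd k \<noteq> 1}. N k)) *
      (\<Prod>i\<in>{1..r}. real (n_step f i 1))"
    unfolding key by simp
  define Z where "Z = (\<Prod>i\<in>{1..r}. real (n_step f i 1))"
  have "Z \<noteq> 0" using True by (simp add: Z_def)
  moreover have "tree_weight = c0 1 * (\<Prod>i\<in>{1..r - 1}. up_slots i) *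
      ((\<Prod>k\<in>classes. fact (N k - 1)) * (\<Prod>k\<in>{k \<in> classes. snd k \<noteq> 1}. N k))"
    unfolding tree_weight_def N_def if_P[OF True] by (simp only: ac_simps)
  ultimately show ?thesis
    unfolding N_def[symmetric] key' Z_def[symmetric] by simp
qed

section \<open>The formula of the theorem as finite products and sums\<close>

lemma Prod_any_fact_n_step:
  "Prod_any (\<lambda>i. \<Prod>s\<in>steps m. fact (n_step f i s)) =
    (\<Prod>k\<in>classes. fact (n_step f (fst k) (snd k)) :: real)"
proof -
  have "Prod_any (\<lambda>i. \<Prod>s\<in>steps m. fact (n_step f i s)) =
      (\<Prod>i\<in>{0..r}. \<Prod>s\<in>steps m. fact (n_step f i s) :: real)"
  proof (rule Prod_any.expand_superset)
    have "(\<Prod>s\<in>steps m. fact (n_step f i s)) = (1 :: real)" if "i \<notin> {0..r}" for i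
    proof (rule prod.neutral, rule ballI)
      fix s
      have "n_step f i s = 0" using n_step_support(1)[of i s] that by blast
      then show "fact (n_step f i s) = (1 :: real)" by simp
    qed
    then show "{i. (\<Prod>s\<in>steps m. fact (n_step f i s)) \<noteq> (1 :: real)} \<subseteq> {0..r}" by blast
  qed simp
  also have "\<dots> = (\<Prod>k\<in>{0..r} \<times> steps m. fact (n_step f (fst k) (snd k)))"
    by (simp add: prod.cartesian_product split_def)
  also have "\<dots> = (\<Prod>k\<in>classes. fact (n_step f (fst k) (snd k)))"
  proof (rule prod.mono_neutral_right)
    show "\<forall>k\<in>{0..r} \<times> steps m - classes. fact (n_step f (fst k) (snd k)) = (1 :: real)"
    proof
      fix k assume "k \<in> {0..r} \<times> steps m - classes"
      then have "n_step f (fst k) (snd k) = 0" by (simp add: classes_def split_def)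
      then show "fact (n_step f (fst k) (snd k)) = (1 :: real)" by simp
    qed
  qed (use classes_subset in auto)
  finally show ?thesis .
qed

lemma Prod_any_fact_mult:
  "Prod_any (\<lambda>i. \<Prod>s\<in>steps m. Prod_any (\<lambda>c. fact (f i s c))) = (\<Prod>t\<in>box. fact (mult t) :: real)"
proof -
  have vec: "Prod_any (\<lambda>c. fact (f i s c)) = (\<Prod>c\<in>vecs. fact (f i s c) :: real)" for i s
  proof (rule Prod_any.expand_superset[OF finite_vecs])
    have "fact (f i s c) = (1 :: real)" if "c \<notin> vecs" for c
    proof -
      have "f i s c = 0" using vecs_support that by blast
      then show ?thesis by simp
    qed
    then show "{c. fact (f i s c) \<noteq> (1 :: real)} \<subseteq> vecs" by blast
  qed
  have "Prod_any (\<lambda>i. \<Prod>s\<in>steps m. Prod_any (\<lambda>c. fact (f i s c))) =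
      (\<Prod>i\<in>{0..r}. \<Prod>s\<in>steps m. Prod_any (\<lambda>c. fact (f i s c)) :: real)"
  proof (rule Prod_any.expand_superset)
    have "(\<Prod>s\<in>steps m. Prod_any (\<lambda>c. fact (f i s c))) = (1 :: real)" if "i \<notin> {0..r}" for i
    proof -
      have "f i s c = 0" for s c using support(1)[of i s c] that by blast
      then show ?thesis by simp
    qed
    then show "{i. (\<Prod>s\<in>steps m. Prod_any (\<lambda>c. fact (f i s c))) \<noteq> (1 :: real)} \<subseteq> {0..r}" by blast
  qed simp
  also have "\<dots> = (\<Prod>t\<in>box. fact (mult t))"
    by (simp add: vec box_def prod.cartesian_product split_def mult_def)
  finally show ?thesis .
qed

lemma n_children_eq:
  "n_children m c0 f s b =
    (\<Sum>t\<in>box. if snd (snd t) s = b then mult t else 0) + of_bool (s = 1 \<and> b = c0 1)"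
proof -
  have vec: "Sum_any (\<lambda>c. if c s = b then f i t c else 0) = (\<Sum>c\<in>vecs. if c s = b then f i t c else 0)" for i t
    by (rule Sum_any_vecs[of _ i t]) (auto split: if_splits)
  have "Sum_any (\<lambda>i. \<Sum>t\<in>steps m. \<Sum>c\<in>vecs. if c s = b then f i t c else 0) =
      (\<Sum>i\<in>{0..r}. \<Sum>t\<in>steps m. \<Sum>c\<in>vecs. if c s = b then f i t c else 0)"
  proof (rule Sum_any.expand_superset)
    have *: "(\<Sum>t\<in>steps m. \<Sum>c\<in>vecs. if c s = b then f i t c else 0) = 0" if "i \<notin> {0..r}" for i
    proof -
      have "f i t c = 0" for t c using support(1)[of i t c] that by blast
      then have "(if c s = b then f i t c else 0) = 0" for t c by simp
      then show ?thesis by simp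
    qed
    show "{i. (\<Sum>t\<in>steps m. \<Sum>c\<in>vecs. if c s = b then f i t c else 0) \<noteq> 0} \<subseteq> {0..r}"
    proof (rule subsetI, rule ccontr)
      fix i assume "i \<in> {i. (\<Sum>t\<in>steps m. \<Sum>c\<in>vecs. if c s = b then f i t c else 0) \<noteq> 0}" "i \<notin> {0..r}"
      then show False using *[of i] by (simp only: mem_Collect_eq simp_thms)
    qed
  qed simp
  then show ?thesis unfolding n_children_def vec sum_box mult_def prod.case snd_conv by simp
qed

text \<open>The vertices are grouped by their number b of children in direction s. The root is
  counted for s = 1 only; in the other directions it would contribute 0! = 1.\<close>

lemma Prod_any_fact_children:
  "(\<Prod>s\<in>steps m. Prod_any (\<lambda>b. fact b ^ n_children m c0 f s b)) = real child_fact"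
proof -
  have one: "Prod_any (\<lambda>b. fact b ^ n_children m c0 f s b) =
      (\<Prod>t\<in>box. fact (snd (snd t) s) ^ mult t) * (if s = 1 then fact (c0 1) else (1 :: real))" for s
  proof -
    \<comment> \<open>All values of b with a nonzero exponent lie in \<open>B\<close>;
      \<open>c0 1\<close> is inserted for the root, whose vector need not occur in
      \<open>box\<close>.\<close>
    define B where "B = insert (c0 1) ((\<lambda>t. snd (snd t) s) ` box)"
    have fin: "finite B" using finite_box by (simp add: B_def)
    have "Prod_any (\<lambda>b. fact b ^ n_children m c0 f s b) = (\<Prod>b\<in>B. fact b ^ n_children m c0 f s b :: real)"
    proof (rule Prod_any.expand_superset[OF fin])
      have "n_children m c0 f s b = 0" if "b \<notin> B" for b
      proof -
        have "b \<noteq> c0 1" "\<forall>t\<in>box. snd (snd t) s \<noteq> b" using that unfolding B_def by blast+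
        then show ?thesis unfolding n_children_eq by (simp add: sum.neutral)
      qed
      then show "{b. fact b ^ n_children m c0 f s b \<noteq> (1 :: real)} \<subseteq> B" by force
    qed
    also have "\<dots> = (\<Prod>b\<in>B. (\<Prod>t\<in>box. if snd (snd t) s = b then fact b ^ mult t else 1) *
        (if b = c0 1 then (if s = 1 then fact b else 1) else 1))"
    proof (rule prod.cong[OF refl])
      fix b
      have "(fact b :: real) ^ (\<Sum>t\<in>box. if snd (snd t) s = b then mult t else 0) =
          (\<Prod>t\<in>box. if snd (snd t) s = b then fact b ^ mult t else 1)"
        unfolding power_sum by (rule prod.cong) auto
      then show "(fact b :: real) ^ n_children m c0 f s b =
          (\<Prod>t\<in>box. if snd (snd t) s = b then fact b ^ mult t else 1) *
          (if b = c0 1 then (if s = 1 then fact b else 1) else 1)"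
        unfolding n_children_eq power_add by auto
    qed
    also have "\<dots> = (\<Prod>t\<in>box. \<Prod>b\<in>B. if snd (snd t) s = b then fact b ^ mult t else 1) *
        (\<Prod>b\<in>B. if b = c0 1 then (if s = 1 then fact b else 1) else 1)"
      unfolding prod.distrib by (subst prod.swap) simp
    also have "(\<Prod>b\<in>B. if b = c0 1 then (if s = 1 then fact b else 1) else 1) =
        (if s = 1 then fact (c0 1) else (1 :: real))"
      using fin by (simp add: B_def)
    also have "(\<Prod>t\<in>box. \<Prod>b\<in>B. if snd (snd t) s = b then fact b ^ mult t else 1) =
        (\<Prod>t\<in>box. fact (snd (snd t) s) ^ mult t :: real)"
      using fin by (intro prod.cong refl) (auto simp: B_def)
    finally show ?thesis .
  qed
  have "1 \<in> steps m" by (simp add: steps_def)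
  then show ?thesis unfolding one prod.distrib child_fact_def
    by (simp add: prod.swap[of _ box] prod_power_distrib)
qed

lemma Sum_any_up: "Sum_any (\<lambda>b. if b > 0 then b * n_up f i b else 0) = up_slots i"
proof -
  define B where "B = (\<lambda>c. c 1) ` vecs"
  have fin: "finite B" using finite_vecs by (simp add: B_def)
  have up: "n_up f i b = (\<Sum>c\<in>vecs. if c 1 = b then f i 1 c else 0)" for b
    unfolding n_up_def by (rule Sum_any_vecs[of _ i 1]) (auto split: if_splits)
  have "Sum_any (\<lambda>b. if b > 0 then b * n_up f i b else 0) =
      (\<Sum>b\<in>B. if b > 0 then b * n_up f i b else 0)"
  proof (rule Sum_any.expand_superset[OF fin])
    have *: "n_up f i b = 0" if "b \<notin> B" for b
      using that by (auto simp: up B_def intro!: sum.neutral)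
    show "{b. (if b > 0 then b * n_up f i b else 0) \<noteq> 0} \<subseteq> B"
    proof (rule subsetI, rule ccontr)
      fix b assume "b \<in> {b. (if b > 0 then b * n_up f i b else 0) \<noteq> 0}" "b \<notin> B"
      then show False using *[of b] by (simp split: if_splits)
    qed
  qed
  also have "\<dots> = (\<Sum>b\<in>B. \<Sum>c\<in>vecs. if c 1 = b then f i 1 c * b else 0)"
  proof (rule sum.cong[OF refl])
    fix b
    have "(if b > 0 then b * n_up f i b else 0) = b * n_up f i b" by simp
    also have "\<dots> = (\<Sum>c\<in>vecs. if c 1 = b then f i 1 c * b else 0)"
      unfolding up sum_distrib_left by (rule sum.cong) auto
    finally show "(if b > 0 then b * n_up f i b else 0) =
        (\<Sum>c\<in>vecs. if c 1 = b then f i 1 c * b else 0)" .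
  qed
  also have "\<dots> = (\<Sum>c\<in>vecs. \<Sum>b\<in>B. if c 1 = b then f i 1 c * b else 0)" by (rule sum.swap)
  also have "\<dots> = up_slots i"
    unfolding up_slots_def using fin by (intro sum.cong refl) (auto simp: B_def)
  finally show ?thesis .
qed

lemma card_trees:
  "real (card (trees_of_type m c0 f (n_total m f))) =
      (real (c0 1) * fact (n_total m f) * Prod_any (\<lambda>i. \<Prod>s\<in>steps m. fact (n_step f i s)))
      / (Prod_any (\<lambda>i. \<Prod>s\<in>steps m. Prod_any (\<lambda>c. fact (f i s c)))
         * (\<Prod>i\<in>{1..r}. real (n_step f i 1))
         * (\<Prod>s\<in>steps m. Prod_any (\<lambda>b. fact b ^ n_children m c0 f s b)))
      * (\<Prod>i\<in>{1..r - 1}. real (Sum_any (\<lambda>b. if b > 0 then b * n_up f i b else 0)))"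
proof -
  define P where "P = (\<Prod>t\<in>box. fact (mult t) :: nat)"
  have P: "(\<Prod>t\<in>box. fact (mult t)) = real P" "P > 0" by (auto simp: P_def intro!: prod_pos)
  have "real (card (trees_of_type m c0 f (n_total m f)) * child_fact * P) =
      real (fact (n_total m f) * tree_weight)"
    unfolding P_def card_trees_times ..
  then have "real (card (trees_of_type m c0 f (n_total m f))) =
      fact (n_total m f) * real tree_weight / (real P * real child_fact)"
    using P(2) child_fact_pos by (simp add: field_simps)
  then show ?thesis
    unfolding Prod_any_fact_n_step Prod_any_fact_mult Prod_any_fact_children Sum_any_up P tree_weight_eq
    by (simp add: ac_simps)
qed

end

theorem theorem2p6:
  fixes m r :: int
    and c0 :: "int \<Rightarrow> nat"
    and f :: "int \<Rightarrow> int \<Rightarrow> (int \<Rightarrow> nat) \<Rightarrow> nat"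
  assumes m: "m \<le> 1"
    and c0: "c0 \<in> child_vectors m" "\<And>k. k \<noteq> 1 \<Longrightarrow> c0 k = 0"
    and domain: "\<And>i s c. f i s c \<noteq> 0 \<Longrightarrow> s \<in> steps m \<and> c \<in> child_vectors m"
    and finite_support: "finite {(i, s, c). f i s c \<noteq> 0}"
    and zero: "\<And>i s c. i < 0 \<or> c 0 > 0 \<Longrightarrow> f i s c = 0"
    and compatible: "\<And>i s. s \<in> steps m \<Longrightarrow>
      of_bool (i = s) * c0 s + (\<Sum>t\<in>steps m. Sum_any (\<lambda>c. c s * f (i - s) t c))
        = Sum_any (\<lambda>c. f i s c)"
    and r_largest: "n_level m f r > 0" "\<And>i. n_level m f i > 0 \<Longrightarrow> i \<le> r"
    and r_pos: "r \<ge> 1"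
    and levels: "\<And>i. 0 \<le> i \<Longrightarrow> i \<le> r \<Longrightarrow> n_level m f i > 0"
  shows "real (card (trees_of_type m c0 f (n_total m f))) =
      (real (c0 1) * fact (n_total m f) * Prod_any (\<lambda>i. \<Prod>s\<in>steps m. fact (n_step f i s)))
      / (Prod_any (\<lambda>i. \<Prod>s\<in>steps m. Prod_any (\<lambda>c. fact (f i s c)))
         * (\<Prod>i\<in>{1..r}. real (n_step f i 1))
         * (\<Prod>s\<in>steps m. Prod_any (\<lambda>b. fact b ^ n_children m c0 f s b)))
      * (\<Prod>i\<in>{1..r - 1}. real (Sum_any (\<lambda>b. if b > 0 then b * n_up f i b else 0)))"
proof -
  interpret tree_profile m r c0 f
    using assms by unfold_locales
  show ?thesis by (rule card_trees)
qed

end
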